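(* Let $F\in C^2(\mathbb{R})$ be uniformly convex, and suppose $(x(s,t),u(s))=(s+F'(g(s))t,\,g(s))$ is an equal area curve associated with the entropy satisfying weak solution of the Cauchy problem $u_t+(F(u))_x=0$, $u(x,0)=g(x)$. In addition, suppose that $(x(s,t),u(s))$ has exactly two shocks, which collide at $t=t^*$. Then, at $t=t^*$, $(x(s,t^* ),u(s))$ is an equal area curve with exactly one shock at the point of collision, which propagates at the Rankine-Hugoniot speed; that is, a shock with position $S(t)$, top value $u_{max}$ and bottom value $u_{min}$ propagates with $\dot S=\frac{F(u_{max})-F(u_{min})}{u_{max}-u_{min}}$.
   Context: Equal area curve: for a parametrized curve $(x(s,t),u(s))$ consider the set of pairs $\mathcal{S}(t)=\{(s_0,s_1)\in\mathbb{R}^2 : x(s_0,t)=x(s_1,t),\ \int_{s_0}^{s_1}x_s(s,t)u(s)\,ds=0\}$, where each pair is additionally required to satisfy $u(s_0)>u(s_1)$, $\lim_{s\to s_0^-}x_s(s,t)>0$ and $\lim_{s\to s_1^+}x_s(s,t)>0$. If replacing $(x(s,t),u(s))$ between each pair $(s_0,s_1)\in\mathcal{S}(t)$ by a vertical line yields a piecewise $C^1$ function with jump discontinuities, the curve is called an equal area curve. The curve is associated with a weak solution when the function obtained by this replacement is that weak solution at time $t$; the vertical lines so obtained are the shocks, with $(x(s_0,t),u(s_0))$ the top and $(x(s_1,t),u(s_1))$ the bottom of the shock. The two shocks collide at $t^*$ means that they are distinct for times before $t^*$ and their positions coincide for the first time at $t=t^*$.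
   Formalization: Added: up to and including t*, the weak solution is piecewise C^1 and continuous off the two shocks (else x_s may tend to 0 at the merged shock at t* ). The shocks are the disjoint pairs of S(t) actually cut, not all of S(t); g is continuous and piecewise C^1. *)

theory Defs
  imports "HOL-Analysis.Analysis"
begin

section \<open>Piecewise smooth functions\<close>

text \<open>Break points are locally finite; at each of them the function and its derivative have finite
  one-sided limits, so jumps and kinks are allowed but vertical tangents are not.\<close>

definition has_one_sided_limits :: "(real \<Rightarrow> real) \<Rightarrow> real \<Rightarrow> bool" where
  "has_one_sided_limits f y \<longleftrightarrow>
     (\<exists>l. (f \<longlongrightarrow> l) (at_left y)) \<and> (\<exists>l. (f \<longlongrightarrow> l) (at_right y))"

definition piecewise_C1 :: "(real \<Rightarrow> real) \<Rightarrow> bool" where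
  "piecewise_C1 v \<longleftrightarrow>
     (\<exists>D. (\<forall>a b. finite (D \<inter> {a..b})) \<and>
          (\<forall>y. y \<notin> D \<longrightarrow> v differentiable (at y)) \<and>
          continuous_on (- D) (deriv v) \<and>
          (\<forall>y\<in>D. has_one_sided_limits v y \<and> has_one_sided_limits (deriv v) y))"


section \<open>Equal area curves\<close>

text \<open>A curve is given by \<open>x s t\<close> and \<open>u s\<close>; \<open>LBINT\<close> is the oriented integral.\<close>

definition equal_area_pairs ::
    "(real \<Rightarrow> real \<Rightarrow> real) \<Rightarrow> (real \<Rightarrow> real) \<Rightarrow> real \<Rightarrow> (real \<times> real) set" where
  "equal_area_pairs x u t =
     {(s0, s1). x s0 t = x s1 t \<and>
        (LBINT s=ereal s0..ereal s1. deriv (\<lambda>r. x r t) s * u s) = 0 \<and>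
        u s0 > u s1 \<and>
        (\<exists>l>0. (deriv (\<lambda>r. x r t) \<longlongrightarrow> l) (at_left s0)) \<and>
        (\<exists>l>0. (deriv (\<lambda>r. x r t) \<longlongrightarrow> l) (at_right s1))}"

text \<open>The curve at time \<open>t\<close> after replacing, for every pair in \<open>\<Sigma>\<close>, the portion between its two
  parameters by a vertical line.\<close>

definition replaced_curve ::
    "(real \<Rightarrow> real \<Rightarrow> real) \<Rightarrow> (real \<Rightarrow> real) \<Rightarrow> real \<Rightarrow> (real \<times> real) set \<Rightarrow> (real \<times> real) set" where
  "replaced_curve x u t \<Sigma> =
     {(x s t, u s) | s. s \<notin> (\<Union>(s0, s1)\<in>\<Sigma>. open_segment s0 s1)} \<union>
     {(x s0 t, y) | s0 s1 y. (s0, s1) \<in> \<Sigma> \<and> y \<in> {u s1..u s0}}"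

text \<open>\<open>v\<close> is the function obtained by the replacement: the replaced curve meets each vertical line
  in a single point, except over the shocks, where it is the vertical line of one pair of \<open>\<Sigma>\<close> and
  \<open>v\<close> jumps from its top down to its bottom.

  The set \<open>\<Sigma>\<close> of shocks is kept explicit, rather than taken to be all of
  \<open>equal_area_pairs x u t\<close>: after two neighbouring folds begin to overlap, the latter set also
  contains a pair formed by the outer branches of both folds, which overlaps the two
  actual shocks and cannot be cut out together with them. Similarly, pairs may survive in the
  interior of a portion already cut out. The shocks that are actually cut are selected by the
  associated weak solution.\<close>

definition replacement_function ::
    "(real \<Rightarrow> real \<Rightarrow> real) \<Rightarrow> (real \<Rightarrow> real) \<Rightarrow> real \<Rightarrow> (real \<times> real) set \<Rightarrow> (real \<Rightarrow> real) \<Rightarrow> bool" where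
  "replacement_function x u t \<Sigma> v \<longleftrightarrow>
     (\<forall>X. let Y = {y. (X, y) \<in> replaced_curve x u t \<Sigma>} in
        Y = {v X} \<or>
        (\<exists>(s0, s1)\<in>\<Sigma>. x s0 t = X \<and> Y = {u s1..u s0} \<and> v X \<in> Y \<and>
           (v \<longlongrightarrow> u s0) (at_left X) \<and> (v \<longlongrightarrow> u s1) (at_right X)))"

definition equal_area_curve ::
    "(real \<Rightarrow> real \<Rightarrow> real) \<Rightarrow> (real \<Rightarrow> real) \<Rightarrow> real \<Rightarrow> (real \<times> real) set \<Rightarrow> (real \<Rightarrow> real) \<Rightarrow> bool" where
  "equal_area_curve x u t \<Sigma> v \<longleftrightarrow>
     \<Sigma> \<subseteq> equal_area_pairs x u t \<and>
     (\<forall>p\<in>\<Sigma>. \<forall>q\<in>\<Sigma>. p \<noteq> q \<longrightarrow>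
        open_segment (fst p) (snd p) \<inter> open_segment (fst q) (snd q) = {}) \<and>
     replacement_function x u t \<Sigma> v \<and> piecewise_C1 v"

text \<open>For a given solution \<open>w\<close> (with \<open>w X t\<close> its value at position \<open>X\<close> and time \<open>t\<close>), the set
  \<open>\<Sigma>\<close> is the set of its shocks at time \<open>t\<close>. For characteristic curves it is determined by
  \<open>w\<close>: the one-sided limits of \<open>v\<close> at a jump give \<open>u s0\<close> and \<open>u s1\<close>, and \<open>s = x s t - F' (u s) t\<close>.\<close>

definition associated_equal_area_curve ::
    "(real \<Rightarrow> real \<Rightarrow> real) \<Rightarrow> (real \<Rightarrow> real) \<Rightarrow> (real \<Rightarrow> real \<Rightarrow> real) \<Rightarrow> real \<Rightarrow>
     (real \<times> real) set \<Rightarrow> bool" where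
  "associated_equal_area_curve x u w t \<Sigma> \<longleftrightarrow>
     (\<exists>v. equal_area_curve x u t \<Sigma> v \<and> (AE X in lebesgue. w X t = v X))"

text \<open>From time \<open>\<tau>\<close> on, for a positive time, the shock \<open>(s0, s1)\<close> continues as a vertical line
  \<open>(\<sigma>0 t, \<sigma>1 t)\<close> with equal areas, whose replacement makes the curve near the shock a
  graph with one jump, and whose position moves with the Rankine-Hugoniot speed
  (one-sided derivative at \<open>\<tau>\<close>).\<close>

definition propagates_at_RH_speed ::
    "(real \<Rightarrow> real) \<Rightarrow> (real \<Rightarrow> real \<Rightarrow> real) \<Rightarrow> (real \<Rightarrow> real) \<Rightarrow> real \<Rightarrow> real \<Rightarrow> real \<Rightarrow> bool" where
  "propagates_at_RH_speed F x u \<tau> s0 s1 \<longleftrightarrow>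
     (\<exists>\<epsilon>>0. \<exists>\<delta>>0. \<exists>\<sigma>0 \<sigma>1 :: real \<Rightarrow> real.
        \<sigma>0 \<tau> = s0 \<and> \<sigma>1 \<tau> = s1 \<and>
        continuous_on {\<tau>..<\<tau> + \<epsilon>} \<sigma>0 \<and> continuous_on {\<tau>..<\<tau> + \<epsilon>} \<sigma>1 \<and>
        (\<forall>t\<in>{\<tau>..<\<tau> + \<epsilon>}.
           (\<sigma>0 t, \<sigma>1 t) \<in> equal_area_pairs x u t \<and>
           s0 - \<delta> < \<sigma>0 t \<and> \<sigma>0 t < \<sigma>1 t \<and> \<sigma>1 t < s1 + \<delta> \<and>
           strict_mono_on {s0 - \<delta>..\<sigma>0 t} (\<lambda>s. x s t) \<and>
           strict_mono_on {\<sigma>1 t..s1 + \<delta>} (\<lambda>s. x s t) \<and>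
           ((\<lambda>r. x (\<sigma>0 r) r) has_real_derivative
              (F (u (\<sigma>0 t)) - F (u (\<sigma>1 t))) / (u (\<sigma>0 t) - u (\<sigma>1 t)))
             (at t within {\<tau>..<\<tau> + \<epsilon>})))"


section \<open>The conservation law\<close>

definition C2 :: "(real \<Rightarrow> real) \<Rightarrow> bool" where
  "C2 F \<longleftrightarrow> (\<forall>y. F differentiable (at y)) \<and> (\<forall>y. deriv F differentiable (at y)) \<and>
            continuous_on UNIV (deriv (deriv F))"

definition uniformly_convex :: "(real \<Rightarrow> real) \<Rightarrow> bool" where
  "uniformly_convex F \<longleftrightarrow> (\<exists>c>0. \<forall>y. deriv (deriv F) y \<ge> c)"

definition characteristic_curve ::
    "(real \<Rightarrow> real) \<Rightarrow> (real \<Rightarrow> real) \<Rightarrow> real \<Rightarrow> real \<Rightarrow> real" where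
  "characteristic_curve F g s t = s + deriv F (g s) * t"

text \<open>Test functions are restrictions to \<open>t \<ge> 0\<close> of compactly supported \<open>C1\<close> functions on the
  plane; they need not vanish at \<open>t = 0\<close>.\<close>

definition test_function ::
    "(real \<Rightarrow> real \<Rightarrow> real) \<Rightarrow> (real \<Rightarrow> real \<Rightarrow> real) \<Rightarrow> (real \<Rightarrow> real \<Rightarrow> real) \<Rightarrow> bool" where
  "test_function \<phi> \<phi>x \<phi>t \<longleftrightarrow>
     (\<forall>X t. ((\<lambda>r. \<phi> r t) has_real_derivative \<phi>x X t) (at X)) \<and>
     (\<forall>X t. ((\<lambda>r. \<phi> X r) has_real_derivative \<phi>t X t) (at t)) \<and>
     continuous_on UNIV (\<lambda>(X, t). \<phi>x X t) \<and> continuous_on UNIV (\<lambda>(X, t). \<phi>t X t) \<and>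
     (\<exists>R. \<forall>X t. \<phi> X t \<noteq> 0 \<longrightarrow> \<bar>X\<bar> \<le> R \<and> \<bar>t\<bar> \<le> R)"

abbreviation half_plane :: "(real \<times> real) set" where
  "half_plane \<equiv> UNIV \<times> {0..}"

text \<open>Bounded weak solutions, continuous in time with values in locally integrable functions,
  which makes \<open>w\<close> at a fixed time well defined almost everywhere, with Kruzkov's entropy inequality.\<close>

definition weak_solution ::
    "(real \<Rightarrow> real) \<Rightarrow> (real \<Rightarrow> real) \<Rightarrow> (real \<Rightarrow> real \<Rightarrow> real) \<Rightarrow> bool" where
  "weak_solution F g w \<longleftrightarrow>
     set_borel_measurable lebesgue half_plane (\<lambda>(X, t). w X t) \<and>
     (\<forall>t\<ge>0. (\<lambda>X. w X t) \<in> borel_measurable lebesgue) \<and>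
     (\<exists>M. \<forall>t\<ge>0. AE X in lebesgue. \<bar>w X t\<bar> \<le> M) \<and>
     (\<forall>t\<ge>0. \<forall>R>0.
        ((\<lambda>r. LINT X:{- R..R}|lebesgue. \<bar>w X r - w X t\<bar>) \<longlongrightarrow> 0) (at t within {0..})) \<and>
     (AE X in lebesgue. w X 0 = g X) \<and>
     (\<forall>\<phi> \<phi>x \<phi>t. test_function \<phi> \<phi>x \<phi>t \<longrightarrow>
        (LINT (X, t):half_plane|lebesgue. w X t * \<phi>t X t + F (w X t) * \<phi>x X t) +
        (LINT X|lebesgue. g X * \<phi> X 0) = 0)"

definition entropy_weak_solution ::
    "(real \<Rightarrow> real) \<Rightarrow> (real \<Rightarrow> real) \<Rightarrow> (real \<Rightarrow> real \<Rightarrow> real) \<Rightarrow> bool" where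
  "entropy_weak_solution F g w \<longleftrightarrow>
     weak_solution F g w \<and>
     (\<forall>k \<phi> \<phi>x \<phi>t. test_function \<phi> \<phi>x \<phi>t \<longrightarrow> (\<forall>X t. \<phi> X t \<ge> 0) \<longrightarrow>
        (LINT (X, t):half_plane|lebesgue.
           \<bar>w X t - k\<bar> * \<phi>t X t + sgn (w X t - k) * (F (w X t) - F k) * \<phi>x X t) +
        (LINT X|lebesgue. \<bar>g X - k\<bar> * \<phi> X 0) \<ge> 0)"


section \<open>Two colliding shocks\<close>

text \<open>The paths \<open>P\<close> and \<open>Q\<close> are the positions of the two shocks; a path is extended to the time
  \<open>tc\<close> of collision by continuity. The shocks of a continuous initial curve appear only at positive
  times, so two shocks exist from some time \<open>t0 \<ge> 0\<close> on. Before the collision the curve is the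
  associated equal area curve with exactly these two shocks. Nothing is required of the
  curve at \<open>tc\<close> itself.\<close>

definition two_shocks_collide ::
    "(real \<Rightarrow> real \<Rightarrow> real) \<Rightarrow> (real \<Rightarrow> real) \<Rightarrow> (real \<Rightarrow> real \<Rightarrow> real) \<Rightarrow> real \<Rightarrow> real \<Rightarrow>
     (real \<Rightarrow> real) \<Rightarrow> (real \<Rightarrow> real) \<Rightarrow> bool" where
  "two_shocks_collide x u w t0 tc P Q \<longleftrightarrow>
     0 \<le> t0 \<and> t0 < tc \<and>
     continuous_on {t0<..tc} P \<and> continuous_on {t0<..tc} Q \<and>
     (\<forall>t\<in>{t0<..<tc}. P t \<noteq> Q t \<and>
        (\<exists>a0 a1 b0 b1. associated_equal_area_curve x u w t {(a0, a1), (b0, b1)} \<and>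
           x a0 t = P t \<and> x b0 t = Q t)) \<and>
     P tc = Q tc"

text \<open>The solution is piecewise smooth up to and including time \<open>tc\<close>, with no discontinuities
  other than the shocks at \<open>P\<close> and \<open>Q\<close>.\<close>

definition piecewise_smooth_except_shocks ::
    "(real \<Rightarrow> real \<Rightarrow> real) \<Rightarrow> real \<Rightarrow> real \<Rightarrow> (real \<Rightarrow> real) \<Rightarrow> (real \<Rightarrow> real) \<Rightarrow> bool" where
  "piecewise_smooth_except_shocks w t0 tc P Q \<longleftrightarrow>
     (\<forall>t\<in>{t0<..tc}. \<exists>v. piecewise_C1 v \<and> continuous_on (- {P t, Q t}) v \<and>
        (AE X in lebesgue. w X t = v X))"

end

theory Submission
  imports Defs
begin

text \<open>Write \<open>h = F' \<circ> g\<close>, so that \<open>x s t = s + h s \<cdot> t\<close>, and let \<open>J\<close> be the potential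
  \<open>J s t = \<integral>\<^sub>0\<^sup>s g + t (g h - F (g))\<close>. Since \<open>J\<^sub>s = g x\<^sub>s\<close>, the equal area condition says that
  \<open>J\<close> takes the same value at both ends of the vertical line. Let \<open>a\<^sub>0 < a\<^sub>1 \<le> b\<^sub>0 < b\<^sub>1\<close> be the ends of
  the two shocks before the collision. The curve is monotone on the branches outside the shocks, and
  the ends stay bounded, so they have limits along a sequence of times tending to the collision time.
  There the middle branch is monotone between two points on the same vertical line, hence is part of
  that line and carries no area: \<open>J\<close> agrees at the limits of \<open>a\<^sub>0\<close> and \<open>b\<^sub>1\<close>. These limits are
  distinct, because otherwise \<open>s + h s \<cdot> t\<close> would be monotone in \<open>s\<close> at the collision time, thus
  strictly monotone at all earlier positive times. Continuity of the solution off the shock excludes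
  vertical pieces in the outer branches, and smoothness up to the shock excludes vertical tangents at its ends.

  After the collision the position of the vertical line is found from the intermediate value
  theorem. For two positions of it, a mean value theorem \<open>J q t - J p t = g \<xi> (x q t - x p t)\<close> on the
  outer branches gives an exact difference form of the Rankine-Hugoniot condition, which first yields
  Lipschitz continuity of the position and then its derivative.\<close>

section \<open>Piecewise smooth functions\<close>

lemma locally_finite_eventually_notin:
  fixes D :: "real set"
  assumes "\<And>a b. finite (D \<inter> {a..b})"
  shows "eventually (\<lambda>s. s \<notin> D) (at y)"
proof -
  have "\<not> y islimpt (D \<inter> {y - 1..y + 1})"
    using assms islimpt_finite by blast
  then have "eventually (\<lambda>s. s \<notin> D \<inter> {y - 1..y + 1}) (at y)"
    by (simp add: islimpt_iff_eventually)
  moreover have "eventually (\<lambda>s. s \<in> {y - 1<..<y + 1}) (at y)"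
    by (intro eventually_at_in_open') auto
  ultimately show ?thesis
    by eventually_elim auto
qed

lemma locally_finite_closed:
  fixes D :: "real set"
  assumes "\<And>a b. finite (D \<inter> {a..b})"
  shows "closed D"
  using locally_finite_eventually_notin[OF assms]
  by (auto simp: closed_limpt islimpt_iff_eventually)

lemma locally_finite_countable:
  fixes D :: "real set"
  assumes "\<And>a b. finite (D \<inter> {a..b})"
  shows "countable D"
proof -
  have "D = (\<Union>n. D \<inter> {- real n..real n})"
  proof (intro equalityI subsetI)
    fix s assume "s \<in> D"
    moreover obtain n where "\<bar>s\<bar> \<le> real n"
      using real_arch_simple by blast
    ultimately show "s \<in> (\<Union>n. D \<inter> {- real n..real n})"
      by (auto intro!: exI[of _ n])
  qed auto
  moreover have "countable (\<Union>n. D \<inter> {- real n..real n})"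
    using assms by (intro countable_UN countableI_type countable_finite)
  ultimately show ?thesis
    by (rule ssubst)
qed

lemma isCont_has_one_sided_limits: "isCont f y \<Longrightarrow> has_one_sided_limits f y"
  unfolding has_one_sided_limits_def isCont_def filterlim_at_split by blast

lemma piecewise_C1_one_sided_limits:
  assumes "piecewise_C1 v"
  shows "has_one_sided_limits v y" and "has_one_sided_limits (deriv v) y"
proof -
  obtain D where D: "\<And>a b. finite (D \<inter> {a..b})" "\<And>y. y \<notin> D \<Longrightarrow> v differentiable (at y)"
    "continuous_on (- D) (deriv v)"
    "\<And>y. y \<in> D \<Longrightarrow> has_one_sided_limits v y \<and> has_one_sided_limits (deriv v) y"
    using assms unfolding piecewise_C1_def by metis
  have "open (- D)"
    using locally_finite_closed[OF D(1)] by (rule open_Compl)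
  then have "y \<notin> D \<Longrightarrow> isCont (deriv v) y"
    using D(3) by (simp add: continuous_on_eq_continuous_at)
  moreover have "y \<notin> D \<Longrightarrow> isCont v y"
    using D(2) by (simp add: differentiable_imp_continuous_within)
  ultimately show "has_one_sided_limits v y" and "has_one_sided_limits (deriv v) y"
    using D(4) isCont_has_one_sided_limits by blast+
qed

lemma piecewise_C1_eventually_differentiable:
  assumes "piecewise_C1 v"
  shows "eventually (\<lambda>X. (v has_real_derivative deriv v X) (at X)) (at y)"
proof -
  obtain D where D: "\<And>a b. finite (D \<inter> {a..b})" "\<And>y. y \<notin> D \<Longrightarrow> v differentiable (at y)"
    using assms unfolding piecewise_C1_def by metis
  show ?thesis
    using locally_finite_eventually_notin[OF D(1)]
    by eventually_elim (use D(2) in \<open>simp add: DERIV_deriv_iff_real_differentiable\<close>)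
qed

lemma piecewise_C1_fun_upd:
  assumes "piecewise_C1 v"
  shows "piecewise_C1 (v(y0 := c))"
proof -
  obtain D where D: "\<And>a b. finite (D \<inter> {a..b})" "\<And>y. y \<notin> D \<Longrightarrow> v differentiable (at y)"
    "continuous_on (- D) (deriv v)"
    using assms unfolding piecewise_C1_def by metis
  let ?v = "v(y0 := c)"
  have nhds: "eventually (\<lambda>z. ?v z = v z) (nhds y)" if "y \<noteq> y0" for y
    using t1_space_nhds[OF that] by eventually_elim simp
  have deriv: "deriv ?v y = deriv v y" if "y \<noteq> y0" for y
    using nhds[OF that] by (rule deriv_cong_ev) simp
  have lim: "has_one_sided_limits k y" if "has_one_sided_limits f y" "\<And>z. z \<noteq> y0 \<Longrightarrow> k z = f z"
    for f k y
  proof -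
    have ev: "eventually (\<lambda>z. f z = k z) (at y)"
    proof (cases "y = y0")
      case True
      then show ?thesis by (simp add: eventually_at_filter that(2))
    next
      case False
      show ?thesis
        using eventually_neq_at_within[of y0 y UNIV] by eventually_elim (simp add: that(2))
    qed
    have left: "(k \<longlongrightarrow> l) (at_left y)" if "(f \<longlongrightarrow> l) (at_left y)" for l
      using ev that unfolding eventually_at_split by (blast intro: Lim_transform_eventually)
    have right: "(k \<longlongrightarrow> l) (at_right y)" if "(f \<longlongrightarrow> l) (at_right y)" for l
      using ev that unfolding eventually_at_split by (blast intro: Lim_transform_eventually)
    show ?thesis
      using that(1) left right unfolding has_one_sided_limits_def by blast
  qed
  show ?thesis
    unfolding piecewise_C1_def
  proof (intro exI[of _ "insert y0 D"] conjI allI impI ballI)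
    show "finite (insert y0 D \<inter> {a..b})" for a b
      using D(1)[of a b] by (simp add: Int_insert_left)
    show "?v differentiable (at y)" if "y \<notin> insert y0 D" for y
    proof -
      from that have "(v has_real_derivative deriv v y) (at y)" "y \<noteq> y0"
        using D(2)[of y] by (auto simp: DERIV_deriv_iff_real_differentiable)
      then have "(?v has_real_derivative deriv v y) (at y)"
        using DERIV_cong_ev[OF refl nhds refl] by blast
      then show ?thesis
        by (auto simp: real_differentiable_def)
    qed
    show "continuous_on (- insert y0 D) (deriv ?v)"
      using D(3) by (rule continuous_on_eq[OF continuous_on_subset]) (auto simp: deriv)
    show "has_one_sided_limits ?v y" for y
      using piecewise_C1_one_sided_limits(1)[OF assms] by (rule lim) auto
    show "has_one_sided_limits (deriv ?v) y" for y
      using piecewise_C1_one_sided_limits(2)[OF assms] by (rule lim) (auto simp: deriv)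
  qed
qed

lemma locally_bounded_on_interval:
  fixes f :: "real \<Rightarrow> real"
  assumes "\<And>y. has_one_sided_limits f y" and "p \<le> q"
  shows "\<exists>B. \<forall>s\<in>{p..q}. \<bar>f s\<bar> \<le> B"
  using \<open>p \<le> q\<close>
proof (induction rule: Bolzano)
  case (trans a b c)
  then obtain B C where "\<forall>s\<in>{a..b}. \<bar>f s\<bar> \<le> B" "\<forall>s\<in>{b..c}. \<bar>f s\<bar> \<le> C"
    by blast
  then have "\<forall>s\<in>{a..c}. \<bar>f s\<bar> \<le> max B C"
    by (metis atLeastAtMost_iff le_max_iff_disj linear)
  then show ?case ..
next
  case (local y)
  have bdd: "\<exists>B. eventually (\<lambda>s. \<bar>f s\<bar> \<le> B) \<F>" if "(f \<longlongrightarrow> l) \<F>" for l \<F>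
  proof -
    have "eventually (\<lambda>s. dist (f s) l < 1) \<F>"
      using that tendstoD zero_less_one by blast
    then have "eventually (\<lambda>s. \<bar>f s\<bar> \<le> \<bar>l\<bar> + 1) \<F>"
      by eventually_elim (auto simp: dist_real_def)
    then show ?thesis ..
  qed
  obtain B1 B2 where "eventually (\<lambda>s. \<bar>f s\<bar> \<le> B1) (at_left y)" "eventually (\<lambda>s. \<bar>f s\<bar> \<le> B2) (at_right y)"
    using assms(1)[of y] bdd unfolding has_one_sided_limits_def by blast
  then have "eventually (\<lambda>s. \<bar>f s\<bar> \<le> max B1 B2) (at y)"
    unfolding eventually_at_split by (auto elim!: eventually_mono)
  then obtain d where d: "d > 0" "\<And>s. s \<noteq> y \<Longrightarrow> dist s y < d \<Longrightarrow> \<bar>f s\<bar> \<le> max B1 B2"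
    unfolding eventually_at by blast
  have "\<forall>s\<in>{a..b}. \<bar>f s\<bar> \<le> max (max B1 B2) \<bar>f y\<bar>" if "a \<le> y \<and> y \<le> b \<and> b - a < d" for a b
  proof
    fix s assume "s \<in> {a..b}"
    then show "\<bar>f s\<bar> \<le> max (max B1 B2) \<bar>f y\<bar>"
      using d(2)[of s] that by (cases "s = y") (auto simp: dist_real_def le_max_iff_disj abs_less_iff)
  qed
  then show ?case
    using d(1) by blast
qed

lemma tendsto_of_lipschitz:
  fixes f :: "real \<Rightarrow> real"
  assumes "\<And>t'. t' \<in> A \<Longrightarrow> \<bar>f t' - c\<bar> \<le> C * \<bar>t' - t\<bar>"
  shows "(f \<longlongrightarrow> c) (at t within A)"
proof -
  have "((\<lambda>t'. C * \<bar>t' - t\<bar>) \<longlongrightarrow> C * \<bar>t - t\<bar>) (at t within A)"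
    by (intro tendsto_intros)
  then have "((\<lambda>t'. f t' - c) \<longlongrightarrow> 0) (at t within A)"
    using assms by (intro Lim_null_comparison[of "\<lambda>t'. f t' - c" "\<lambda>t'. C * \<bar>t' - t\<bar>"])
      (auto simp: eventually_at_filter)
  then show ?thesis
    by (simp add: LIM_zero_cancel)
qed

section \<open>Pointwise bounds and local convergence in the mean\<close>

lemma L1_limit_AE_bound:
  fixes f :: "nat \<Rightarrow> real \<Rightarrow> real"
  assumes [measurable]: "\<And>n. f n \<in> borel_measurable lebesgue" "f' \<in> borel_measurable lebesgue"
    and f_bdd: "\<And>n. AE X in lebesgue. \<bar>f n X\<bar> \<le> M" and f'_bdd: "AE X in lebesgue. \<bar>f' X\<bar> \<le> M"
    and L1: "(\<lambda>n. LINT X:{-R..R}|lebesgue. \<bar>f n X - f' X\<bar>) \<longlonglongrightarrow> 0"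
    and S: "S \<subseteq> {-R..R}" and S_sets[measurable]: "S \<in> sets lebesgue"
    and close: "eventually (\<lambda>n. AE X in lebesgue. X \<in> S \<longrightarrow> \<bar>f n X - k\<bar> \<le> e) sequentially"
  shows "AE X in lebesgue. X \<in> S \<longrightarrow> \<bar>f' X - k\<bar> \<le> e"
proof -
  define \<phi> where "\<phi> X = indicator S X * max 0 (\<bar>f' X - k\<bar> - e)" for X
  have [measurable]: "\<phi> \<in> borel_measurable lebesgue"
    unfolding \<phi>_def by measurable
  have fin: "emeasure lebesgue {-R..R} < \<infinity>"
    by (cases "-R \<le> R") (auto simp: emeasure_lborel_Icc_eq)
  have "integrable lebesgue (\<lambda>X. indicator {-R..R} X *\<^sub>R \<phi> X)"
  proof (rule integrableI_bounded_set_indicator[OF _ _ fin])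
    show "AE X\<in>{-R..R} in lebesgue. norm (\<phi> X) \<le> \<bar>M\<bar> + \<bar>k\<bar> + \<bar>e\<bar>"
      using f'_bdd by eventually_elim (auto simp: \<phi>_def indicator_def)
  qed auto
  moreover have "(\<lambda>X. indicator {-R..R} X *\<^sub>R \<phi> X) = \<phi>"
    using S by (auto simp: fun_eq_iff \<phi>_def indicator_def)
  ultimately have \<phi>_int: "integrable lebesgue \<phi>"
    by simp
  have diff_int: "integrable lebesgue (\<lambda>X. indicator {-R..R} X *\<^sub>R \<bar>f n X - f' X\<bar>)" for n
  proof (rule integrableI_bounded_set_indicator[OF _ _ fin])
    show "AE X\<in>{-R..R} in lebesgue. norm \<bar>f n X - f' X\<bar> \<le> 2 * M"
      using f'_bdd f_bdd[of n] by eventually_elim auto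
  qed auto
  have "eventually (\<lambda>n. (LINT X|lebesgue. \<phi> X) \<le> (LINT X:{-R..R}|lebesgue. \<bar>f n X - f' X\<bar>)) sequentially"
    using close
  proof eventually_elim
    case (elim n)
    show ?case
      unfolding set_lebesgue_integral_def
    proof (rule integral_mono_AE[OF \<phi>_int diff_int])
      show "AE X in lebesgue. \<phi> X \<le> indicator {-R..R} X *\<^sub>R \<bar>f n X - f' X\<bar>"
        using elim by eventually_elim (use S in \<open>auto simp: \<phi>_def indicator_def\<close>)
    qed
  qed
  then have "(LINT X|lebesgue. \<phi> X) \<le> 0"
    using L1 by (intro tendsto_lowerbound[OF L1]) auto
  moreover have nonneg: "\<phi> X \<ge> 0" for X
    by (simp add: \<phi>_def)
  moreover have "(LINT X|lebesgue. \<phi> X) \<ge> 0"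
    by (rule integral_nonneg_AE) (simp add: nonneg)
  ultimately have "(LINT X|lebesgue. \<phi> X) = 0"
    by linarith
  then have "AE X in lebesgue. \<phi> X = 0"
    using integral_nonneg_eq_0_iff_AE[OF \<phi>_int] nonneg by simp
  then show ?thesis
    by eventually_elim (auto simp: \<phi>_def indicator_def max_def split: if_splits)
qed

lemma AE_bound_imp_bound:
  fixes v :: "real \<Rightarrow> real"
  assumes "open S" and "continuous_on S v"
    and "AE X in lebesgue. X \<in> S \<longrightarrow> \<bar>v X - k\<bar> \<le> e" and "X \<in> S"
  shows "\<bar>v X - k\<bar> \<le> e"
proof (rule ccontr)
  assume "\<not> ?thesis"
  let ?B = "{X \<in> S. e < \<bar>v X - k\<bar>}"
  have "open ?B"
    using continuous_open_preimage[OF _ assms(1), of "\<lambda>X. \<bar>v X - k\<bar>" "{e<..}"]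
      continuous_on_rabs[OF continuous_on_diff[OF assms(2) continuous_on_const]]
    by (auto simp: vimage_def Int_def)
  moreover have "X \<in> ?B"
    using \<open>\<not> _\<close> \<open>X \<in> S\<close> by auto
  ultimately have "\<not> negligible ?B"
    using open_not_negligible by blast
  obtain N where "{X \<in> space lebesgue. \<not> (X \<in> S \<longrightarrow> \<bar>v X - k\<bar> \<le> e)} \<subseteq> N"
    "emeasure lebesgue N = 0" "N \<in> sets lebesgue"
    using AE_E[OF assms(3)] by blast
  then have "?B \<subseteq> N" "negligible N"
    by (auto simp: negligible_iff_null_sets null_sets_def)
  then show False
    using \<open>\<not> negligible ?B\<close> negligible_subset by blast
qed

section \<open>The characteristic curve and its area potential\<close>

locale characteristics =
  fixes F g G :: "real \<Rightarrow> real" and D :: "real set" and M :: real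
  assumes F_deriv: "(F has_real_derivative deriv F y) (at y)"
    and F'_deriv: "(deriv F has_real_derivative deriv (deriv F) y) (at y)"
    and F''_cont: "continuous_on UNIV (deriv (deriv F))"
    and F''_pos: "deriv (deriv F) y > 0"
    and g_cont: "continuous_on UNIV g"
    and g_pw: "piecewise_C1 g"
    and g_bound: "\<bar>g s\<bar> \<le> M"
    and G_deriv: "(G has_real_derivative g s) (at s)"
    and D_fin: "finite (D \<inter> {a..b})"
    and g_deriv: "s \<notin> D \<Longrightarrow> (g has_real_derivative deriv g s) (at s)"
    and g'_cont: "continuous_on (- D) (deriv g)"
begin

abbreviation x :: "real \<Rightarrow> real \<Rightarrow> real" where
  "x \<equiv> characteristic_curve F g"

definition h :: "real \<Rightarrow> real" where
  "h s = deriv F (g s)"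

definition J :: "real \<Rightarrow> real \<Rightarrow> real" where
  "J s t = G s + t * (g s * h s - F (g s))"

lemma x_eq: "x s t = s + h s * t"
  by (simp add: characteristic_curve_def h_def)

lemma F'_less: "a < b \<Longrightarrow> deriv F a < deriv F b"
  by (rule DERIV_pos_imp_increasing) (use F'_deriv F''_pos in blast)+

lemma F'_less_iff: "deriv F a < deriv F b \<longleftrightarrow> a < b"
  using F'_less[of a b] F'_less[of b a] by (cases a b rule: linorder_cases) auto

lemma F_above_tangent:
  assumes "a \<noteq> b"
  shows "F b > F a + deriv F a * (b - a)"
proof (cases "a < b")
  case True
  then obtain z where "a < z" "F b - F a = (b - a) * deriv F z"
    using MVT2[of a b F "deriv F"] F_deriv by blast
  then show ?thesis
    using True F'_less[of a z] by (smt (verit) mult.commute mult_strict_left_mono)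
next
  case False
  then have "b < a" using assms by simp
  then obtain z where "z < a" "F a - F b = (a - b) * deriv F z"
    using MVT2[of b a F "deriv F"] F_deriv by blast
  then have "F a - F b < (a - b) * deriv F a"
    using \<open>b < a\<close> F'_less[of z a] by (simp add: mult_strict_left_mono)
  then show ?thesis by (simp add: algebra_simps)
qed

lemma F_cont: "continuous_on A F"
  by (rule DERIV_continuous_on[OF has_field_derivative_at_within[OF F_deriv]])

lemma F'_cont: "continuous_on A (deriv F)"
  by (rule DERIV_continuous_on[OF has_field_derivative_at_within[OF F'_deriv]])

lemma h_cont: "continuous_on A h"
  unfolding h_def
  by (rule continuous_on_compose2[OF F'_cont[of UNIV] continuous_on_subset[OF g_cont]]) auto

lemma G_cont: "continuous_on A G"
  by (rule DERIV_continuous_on[OF has_field_derivative_at_within[OF G_deriv]])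

lemma Fg_cont: "continuous_on A (\<lambda>s. F (g s))"
  by (rule continuous_on_compose2[OF F_cont[of UNIV] continuous_on_subset[OF g_cont]]) auto

lemma g_cont': "continuous_on A g"
  using g_cont continuous_on_subset by blast

lemma x_cont: "continuous_on A (\<lambda>s. x s t)"
  unfolding x_eq by (intro continuous_intros h_cont)

lemma J_cont: "continuous_on A (\<lambda>s. J s t)"
  unfolding J_def by (intro continuous_intros h_cont G_cont Fg_cont g_cont')

lemma tendsto_g: "(f \<longlongrightarrow> s) \<F> \<Longrightarrow> ((\<lambda>n. g (f n)) \<longlongrightarrow> g s) \<F>"
  using g_cont by (simp add: continuous_on_eq_continuous_at isCont_tendsto_compose)

lemma tendsto_h: "(f \<longlongrightarrow> s) \<F> \<Longrightarrow> ((\<lambda>n. h (f n)) \<longlongrightarrow> h s) \<F>"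
  using h_cont[of UNIV] by (simp add: continuous_on_eq_continuous_at isCont_tendsto_compose)

lemma tendsto_x:
  "(f \<longlongrightarrow> s) \<F> \<Longrightarrow> (k \<longlongrightarrow> t) \<F> \<Longrightarrow> ((\<lambda>n. x (f n) (k n)) \<longlongrightarrow> x s t) \<F>"
  unfolding x_eq by (intro tendsto_intros tendsto_h)

lemma tendsto_J:
  assumes "(f \<longlongrightarrow> s) \<F>" and "(k \<longlongrightarrow> t) \<F>"
  shows "((\<lambda>n. J (f n) (k n)) \<longlongrightarrow> J s t) \<F>"
proof -
  have "((\<lambda>n. G (f n)) \<longlongrightarrow> G s) \<F>" "((\<lambda>n. F (g (f n))) \<longlongrightarrow> F (g s)) \<F>"
    using assms G_cont[of UNIV] Fg_cont[of UNIV]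
    by (simp_all add: continuous_on_eq_continuous_at isCont_tendsto_compose[where g = G]
        isCont_tendsto_compose[where g = "\<lambda>s. F (g s)"])
  then show ?thesis
    unfolding J_def by (intro tendsto_intros tendsto_h tendsto_g assms)
qed

lemma h_bounded: "\<exists>H>0. \<forall>s. \<bar>h s\<bar> \<le> H"
proof -
  have "h s \<in> {deriv F (- M)..deriv F M}" for s
    using g_bound[of s] F'_less_iff unfolding h_def by (auto simp: not_less[symmetric])
  then have "\<forall>s. \<bar>h s\<bar> \<le> \<bar>deriv F (- M)\<bar> + \<bar>deriv F M\<bar> + 1"
    by (auto simp: abs_le_iff) (smt (verit))+
  then show ?thesis
    by (intro exI[of _ "\<bar>deriv F (- M)\<bar> + \<bar>deriv F M\<bar> + 1"]) auto
qed

lemma x_displacement_bounded: "\<exists>H>0. \<forall>s t. t \<ge> 0 \<longrightarrow> \<bar>x s t - s\<bar> \<le> H * t"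
proof -
  obtain H where "H > 0" "\<forall>s. \<bar>h s\<bar> \<le> H"
    using h_bounded by blast
  then show ?thesis
    by (intro exI[of _ H]) (simp add: x_eq abs_mult mult_right_mono)
qed

lemma same_x_less_iff:
  assumes "x s t = x s' t" and "t > 0"
  shows "s < s' \<longleftrightarrow> g s' < g s"
proof -
  have "s' - s = (h s - h s') * t"
    using assms by (simp add: x_eq algebra_simps)
  then have "s < s' \<longleftrightarrow> h s' < h s"
    using assms(2) by (smt (verit) zero_less_mult_iff)
  then show ?thesis
    by (simp add: h_def F'_less_iff)
qed

lemma same_x_same_g:
  assumes "x s t = x s' t" and "t > 0" and "g s = g s'"
  shows "s = s'"
  using assms(1,3) by (simp add: x_eq h_def)

lemma x_deriv_at:
  assumes "s \<notin> D"
  shows "((\<lambda>r. x r t) has_real_derivative 1 + deriv (deriv F) (g s) * deriv g s * t) (at s)"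
proof -
  have "((\<lambda>r. deriv F (g r)) has_real_derivative deriv (deriv F) (g s) * deriv g s) (at s)"
    by (rule DERIV_chain2[OF F'_deriv g_deriv[OF assms]])
  then show ?thesis
    unfolding x_eq h_def by (auto intro!: derivative_eq_intros)
qed

lemma deriv_x_eq: "s \<notin> D \<Longrightarrow> deriv (\<lambda>r. x r t) s = 1 + deriv (deriv F) (g s) * deriv g s * t"
  by (rule DERIV_imp_deriv[OF x_deriv_at])

lemma x_deriv: "s \<notin> D \<Longrightarrow> ((\<lambda>r. x r t) has_real_derivative deriv (\<lambda>r. x r t) s) (at s)"
  using x_deriv_at[of s t] by (simp add: deriv_x_eq)

lemma J_deriv:
  assumes "s \<notin> D"
  shows "((\<lambda>r. J r t) has_real_derivative deriv (\<lambda>r. x r t) s * g s) (at s)"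
proof -
  have h': "(h has_real_derivative deriv (deriv F) (g s) * deriv g s) (at s)"
    unfolding h_def using DERIV_chain2[OF F'_deriv g_deriv[OF assms]] by simp
  have Fg: "((\<lambda>s. F (g s)) has_real_derivative deriv F (g s) * deriv g s) (at s)"
    using DERIV_chain2[OF F_deriv g_deriv[OF assms]] by simp
  show ?thesis
    unfolding J_def deriv_x_eq[OF assms]
    by (rule derivative_eq_intros G_deriv h' Fg g_deriv assms refl)+
      (simp add: h_def algebra_simps)
qed

lemma x_has_integral:
  assumes "p \<le> q"
  shows "((\<lambda>s. deriv (\<lambda>r. x r t) s) has_integral x q t - x p t) {p..q}"
  by (rule fundamental_theorem_of_calculus_interior_strong[OF D_fin[of p q] assms _ x_cont])
    (auto simp: has_real_derivative_iff_has_vector_derivative[symmetric] intro!: x_deriv)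

lemma J_has_integral:
  assumes "p \<le> q"
  shows "((\<lambda>s. deriv (\<lambda>r. x r t) s * g s) has_integral J q t - J p t) {p..q}"
  by (rule fundamental_theorem_of_calculus_interior_strong[OF D_fin[of p q] assms _ J_cont])
    (auto simp: has_real_derivative_iff_has_vector_derivative[symmetric] intro!: J_deriv)

lemma countable_D: "countable D"
  using D_fin by (rule locally_finite_countable)

lemma eventually_notin_D: "eventually (\<lambda>s. s \<notin> D) (at y)"
  using D_fin by (rule locally_finite_eventually_notin)

lemma deriv_x_tendsto:
  assumes "(deriv g \<longlongrightarrow> \<gamma>) \<F>" and "\<F> \<le> at y"
  shows "(deriv (\<lambda>r. x r t) \<longlongrightarrow> 1 + deriv (deriv F) (g y) * \<gamma> * t) \<F>"
proof -
  have "((\<lambda>s. s) \<longlongrightarrow> y) \<F>"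
    using assms(2) tendsto_ident_at tendsto_mono by blast
  then have "((\<lambda>s. deriv (deriv F) (g s)) \<longlongrightarrow> deriv (deriv F) (g y)) \<F>"
    using F''_cont by (intro isCont_tendsto_compose[OF _ tendsto_g])
      (simp_all add: continuous_on_eq_continuous_at)
  then have lim: "((\<lambda>s. 1 + deriv (deriv F) (g s) * deriv g s * t)
      \<longlongrightarrow> 1 + deriv (deriv F) (g y) * \<gamma> * t) \<F>"
    by (intro tendsto_intros assms)
  have "eventually (\<lambda>s. 1 + deriv (deriv F) (g s) * deriv g s * t = deriv (\<lambda>r. x r t) s) \<F>"
    using filter_leD[OF assms(2) eventually_notin_D] by eventually_elim (simp add: deriv_x_eq)
  then show ?thesis
    using lim by (simp cong: tendsto_cong)
qed

lemma deriv_x_one_sided_limits: "has_one_sided_limits (deriv (\<lambda>r. x r t)) y"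
proof -
  have "at_left y \<le> at y" "at_right y \<le> at y"
    by (auto simp: at_le)
  then show ?thesis
    using piecewise_C1_one_sided_limits(2)[OF g_pw, of y] deriv_x_tendsto
    unfolding has_one_sided_limits_def by meson
qed

lemma deriv_x_borel: "deriv (\<lambda>r. x r t) \<in> borel_measurable borel"
proof (rule borel_measurable_continuous_countable_exceptions[OF countable_D])
  have "continuous_on (- D) (\<lambda>s. 1 + deriv (deriv F) (g s) * deriv g s * t)"
    by (intro continuous_intros g'_cont continuous_on_compose2[OF F''_cont g_cont']) auto
  then show "continuous_on (- D) (deriv (\<lambda>r. x r t))"
    by (rule continuous_on_eq) (simp add: deriv_x_eq)
qed
lemma area_eq:
  assumes "p \<le> q"
  shows "(LBINT s=ereal p..ereal q. deriv (\<lambda>r. x r t) s * g s) = J q t - J p t"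
proof -
  have "\<exists>B. \<forall>s\<in>{p..q}. \<bar>deriv (\<lambda>r. x r t) s\<bar> \<le> B"
    by (rule locally_bounded_on_interval) (rule deriv_x_one_sided_limits, rule assms)
  then obtain B where B: "\<forall>s\<in>{p..q}. \<bar>deriv (\<lambda>r. x r t) s\<bar> \<le> B"
    by (rule exE)
  have "set_integrable lborel {p..q} (\<lambda>s. deriv (\<lambda>r. x r t) s * g s)"
    unfolding set_integrable_def
  proof (rule integrableI_bounded_set_indicator[where B = "\<bar>B\<bar> * \<bar>M\<bar>"])
    have "g \<in> borel_measurable borel"
      using g_cont by (rule borel_measurable_continuous_onI)
    then show "(\<lambda>s. deriv (\<lambda>r. x r t) s * g s) \<in> borel_measurable lborel"
      using deriv_x_borel by simp
    have "norm (deriv (\<lambda>r. x r t) s * g s) \<le> \<bar>B\<bar> * \<bar>M\<bar>" if "s \<in> {p..q}" for s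
      unfolding real_norm_def abs_mult
      using B[rule_format, OF that] g_bound[of s] by (intro mult_mono) auto
    then show "AE s\<in>{p..q} in lborel. norm (deriv (\<lambda>r. x r t) s * g s) \<le> \<bar>B\<bar> * \<bar>M\<bar>"
      by simp
  qed (auto simp: emeasure_lborel_Icc_eq)
  then show ?thesis
    by (rule trans[OF interval_integral_eq_integral[OF assms] integral_unique[OF J_has_integral[OF assms]]])
qed

lemma deriv_x_nonneg:
  assumes "mono_on {p..q} (\<lambda>s. x s t)" and "s \<in> {p<..<q}" and "s \<notin> D"
  shows "deriv (\<lambda>r. x r t) s \<ge> 0"
  using mono_on_imp_deriv_nonneg[OF assms(1) x_deriv[OF assms(3)]] assms(2)
  by (simp add: interior_atLeastAtMost_real)

lemma J_mean_value:
  assumes "p \<le> q" and mono: "mono_on {p..q} (\<lambda>s. x s t)"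
  shows "\<exists>\<xi>\<in>{p..q}. J q t - J p t = g \<xi> * (x q t - x p t)"
proof -
  let ?N = "D \<inter> {p..q} \<union> {p, q}"
  have neg: "negligible ?N"
    using D_fin by (intro negligible_finite) auto
  let ?\<Delta> = "x q t - x p t"
  obtain a where a: "a \<in> {p..q}" "\<And>s. s \<in> {p..q} \<Longrightarrow> g a \<le> g s"
    using continuous_attains_inf[OF compact_Icc _ g_cont', of p q] assms(1) by auto
  obtain b where b: "b \<in> {p..q}" "\<And>s. s \<in> {p..q} \<Longrightarrow> g s \<le> g b"
    using continuous_attains_sup[OF compact_Icc _ g_cont', of p q] assms(1) by auto
  let ?f = "\<lambda>s. deriv (\<lambda>r. x r t) s" and ?k = "\<lambda>s. if s \<in> ?N then 0 else deriv (\<lambda>r. x r t) s"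
  have k: "(?k has_integral ?\<Delta>) {p..q}"
    by (rule has_integral_spike[OF neg _ x_has_integral[OF assms(1)]]) auto
  have kg: "((\<lambda>s. ?k s * g s) has_integral J q t - J p t) {p..q}"
    by (rule has_integral_spike[OF neg _ J_has_integral[OF assms(1)]]) auto
  have nonneg: "?k s \<ge> 0" if "s \<in> {p..q}" for s
    using that deriv_x_nonneg[OF mono, of s] by auto
  have "?\<Delta> * g a \<le> J q t - J p t"
    using has_integral_le[OF has_integral_mult_left[OF k, of "g a"] kg] nonneg a(2)
    by (simp add: mult_left_mono)
  moreover have "J q t - J p t \<le> ?\<Delta> * g b"
    using has_integral_le[OF kg has_integral_mult_left[OF k, of "g b"]] nonneg b(2)
    by (simp add: mult_left_mono)
  ultimately have bounds: "?\<Delta> * g a \<le> J q t - J p t" "J q t - J p t \<le> ?\<Delta> * g b" .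
  show ?thesis
  proof (cases "?\<Delta> = 0")
    case True
    then show ?thesis
      using bounds assms(1) by auto
  next
    case False
    then have pos: "?\<Delta> > 0"
      using mono_onD[OF mono, of p q] assms(1) by auto
    let ?z = "(J q t - J p t) / ?\<Delta>"
    have z: "g a \<le> ?z" "?z \<le> g b"
      using bounds pos by (simp_all add: pos_le_divide_eq pos_divide_le_eq mult.commute)
    have "connected (g ` {p..q})"
      by (intro connected_continuous_image g_cont') simp
    then have "?z \<in> g ` {p..q}"
      using z a(1) b(1) by (meson connectedD_interval imageI)
    then show ?thesis
      using pos by (auto simp: field_simps)
  qed
qed

section \<open>The curve before the collision\<close>

lemma equal_area_pairs_iff:
  assumes "t > 0"
  shows "(p0, p1) \<in> equal_area_pairs x g t \<longleftrightarrow>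
    p0 < p1 \<and> x p0 t = x p1 t \<and> J p0 t = J p1 t \<and>
    (\<exists>l>0. (deriv (\<lambda>r. x r t) \<longlongrightarrow> l) (at_left p0)) \<and>
    (\<exists>l>0. (deriv (\<lambda>r. x r t) \<longlongrightarrow> l) (at_right p1))"
proof (cases "p0 < p1 \<and> x p0 t = x p1 t")
  case True
  then have "g p1 < g p0"
    using same_x_less_iff assms by blast
  moreover have "(LBINT s=ereal p0..ereal p1. deriv (\<lambda>r. x r t) s * g s) = J p1 t - J p0 t"
    using True by (simp add: area_eq)
  ultimately show ?thesis
    using True by (auto simp: equal_area_pairs_def)
next
  case False
  then have "\<not> (x p0 t = x p1 t \<and> g p0 > g p1)"
    using same_x_less_iff[of p0 t p1] assms by blast
  then show ?thesis
    using False by (auto simp: equal_area_pairs_def)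
qed

lemma equal_area_curve_pair:
  assumes "equal_area_curve x g t \<Sigma> v" and "t > 0" and "(p0, p1) \<in> \<Sigma>"
  shows "p0 < p1" and "x p0 t = x p1 t" and "J p0 t = J p1 t"
proof -
  have "(p0, p1) \<in> equal_area_pairs x g t"
    using assms unfolding equal_area_curve_def by blast
  then show "p0 < p1" and "x p0 t = x p1 t" and "J p0 t = J p1 t"
    by (simp_all add: equal_area_pairs_iff[OF assms(2)])
qed

lemma outside_cuts_in_replaced_curve:
  assumes curve: "equal_area_curve x g t \<Sigma> v" and "t > 0"
    and "\<And>p0 p1. (p0, p1) \<in> \<Sigma> \<Longrightarrow> s \<notin> {p0<..<p1}"
  shows "(x s t, g s) \<in> replaced_curve x g t \<Sigma>"
proof -
  have "s \<notin> (\<Union>(p0, p1)\<in>\<Sigma>. open_segment p0 p1)"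
    using assms(3) equal_area_curve_pair(1)[OF curve \<open>t > 0\<close>]
    by (fastforce simp: open_segment_eq_real_ivl)
  then show ?thesis
    by (auto simp: replaced_curve_def)
qed

lemma replaced_at:
  assumes curve: "equal_area_curve x g t \<Sigma> v" and "t > 0"
    and "\<And>p0 p1. (p0, p1) \<in> \<Sigma> \<Longrightarrow> s \<notin> {p0<..<p1}"
  shows "v (x s t) = g s \<and> {y. (x s t, y) \<in> replaced_curve x g t \<Sigma>} = {g s}
    \<or> (\<exists>p0 p1. (p0, p1) \<in> \<Sigma> \<and> (s = p0 \<or> s = p1) \<and> x p0 t = x s t \<and>
         {y. (x s t, y) \<in> replaced_curve x g t \<Sigma>} = {g p1..g p0})"
proof -
  let ?Y = "{y. (x s t, y) \<in> replaced_curve x g t \<Sigma>}"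
  have g: "g s \<in> ?Y"
    using outside_cuts_in_replaced_curve[OF curve \<open>t > 0\<close> assms(3)] by simp
  have "?Y = {v (x s t)} \<or> (\<exists>(p0, p1)\<in>\<Sigma>. x p0 t = x s t \<and> ?Y = {g p1..g p0})"
    using curve unfolding equal_area_curve_def replacement_function_def Let_def by blast
  then consider "?Y = {v (x s t)}"
    | p0 p1 where "(p0, p1) \<in> \<Sigma>" "x p0 t = x s t" "?Y = {g p1..g p0}"
    by auto
  then show ?thesis
  proof cases
    case 1
    then show ?thesis using g by auto
  next
    case 2
    have "g p1 \<le> g s" "g s \<le> g p0"
      using g 2(3) by auto
    moreover have "x s t = x p1 t"
      using equal_area_curve_pair(2)[OF curve \<open>t > 0\<close> 2(1)] 2(2) by simp
    ultimately have "p0 \<le> s" "s \<le> p1"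
      using same_x_less_iff[of s t p0] same_x_less_iff[of p1 t s] 2(2) \<open>t > 0\<close> by auto
    then show ?thesis
      using assms(3)[OF 2(1)] 2 by fastforce
  qed
qed

lemma same_x_outside_cuts:
  assumes curve: "equal_area_curve x g t \<Sigma> v" and "t > 0"
    and "\<And>p0 p1. (p0, p1) \<in> \<Sigma> \<Longrightarrow> s \<notin> {p0<..<p1} \<and> s' \<notin> {p0<..<p1}"
    and "x s t = x s' t" and "s < s'"
  shows "(s, s') \<in> \<Sigma>"
proof -
  have ne: "g s \<noteq> g s'"
    using same_x_same_g assms(2,4,5) by blast
  have s: "g s \<in> {y. (x s t, y) \<in> replaced_curve x g t \<Sigma>}"
    and s': "g s' \<in> {y. (x s t, y) \<in> replaced_curve x g t \<Sigma>}"
    using outside_cuts_in_replaced_curve[OF curve \<open>t > 0\<close>, of s]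
      outside_cuts_in_replaced_curve[OF curve \<open>t > 0\<close>, of s'] assms(3,4) by simp_all
  have "\<exists>p0 p1. (p0, p1) \<in> \<Sigma> \<and> (s = p0 \<or> s = p1) \<and> x p0 t = x s t \<and>
         {y. (x s t, y) \<in> replaced_curve x g t \<Sigma>} = {g p1..g p0}"
  proof -
    have "{y. (x s t, y) \<in> replaced_curve x g t \<Sigma>} \<noteq> {g s}"
      using s' ne by (metis singletonD)
    moreover have "s \<notin> {p0<..<p1}" if "(p0, p1) \<in> \<Sigma>" for p0 p1
      using assms(3)[OF that] ..
    ultimately show ?thesis
      using replaced_at[OF curve \<open>t > 0\<close>, of s] by blast
  qed
  then obtain p0 p1 where p: "(p0, p1) \<in> \<Sigma>" "s = p0 \<or> s = p1" "x p0 t = x s t"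
    "{y. (x s t, y) \<in> replaced_curve x g t \<Sigma>} = {g p1..g p0}"
    by blast
  then have "g p1 \<le> g s'"
    using s' by auto
  moreover have xp: "x p0 t = x p1 t"
    by (rule equal_area_curve_pair(2)[OF curve \<open>t > 0\<close> p(1)])
  ultimately have "s' \<le> p1"
    using same_x_less_iff[of p1 t s'] assms(2,4) p(3) by auto
  then show ?thesis
    using assms(3)[OF p(1)] assms(5) p by fastforce
qed

lemma inj_ray_strict_mono:
  assumes "t > 0" and inj: "inj_on (\<lambda>s. x s t) S" and S: "S = {..a} \<or> S = {a..}"
  shows "strict_mono_on S (\<lambda>s. x s t)"
proof (rule ccontr)
  assume "\<not> ?thesis"
  moreover have "is_interval S"
    using S by (auto simp: is_interval_ic is_interval_ci)
  ultimately have anti: "strict_antimono_on S (\<lambda>s. x s t)"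
    using inj injective_eq_monotone_map[OF _ x_cont, of S t] by blast
  obtain H where H: "H > 0" and bound: "\<And>s. \<bar>x s t - s\<bar> \<le> H * t"
    using x_displacement_bounded assms(1) less_imp_le by metis
  have "H * t > 0"
    using H assms(1) by simp
  then obtain s1 s2 where s: "s1 \<in> S" "s2 \<in> S" "s2 - s1 > 2 * (H * t)"
  proof -
    from S show thesis
    proof
      assume "S = {..a}"
      then show thesis
        using \<open>H * t > 0\<close> by (intro that[of "a - 2 * (H * t) - 1" a]) auto
    next
      assume "S = {a..}"
      then show thesis
        using \<open>H * t > 0\<close> by (intro that[of a "a + 2 * (H * t) + 1"]) auto
    qed
  qed
  then have "x s2 t < x s1 t"
    using anti \<open>H * t > 0\<close> by (auto simp: monotone_on_def)
  then show False
    using bound[of s1] bound[of s2] s(3) by linarith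
qed

definition two_cuts :: "real \<Rightarrow> (real \<Rightarrow> real) \<Rightarrow> real \<Rightarrow> real \<Rightarrow> real \<Rightarrow> real \<Rightarrow> bool" where
  "two_cuts t v a0 a1 b0 b1 \<longleftrightarrow>
     a0 < a1 \<and> a1 \<le> b0 \<and> b0 < b1 \<and> x a0 t = x a1 t \<and> x b0 t = x b1 t \<and>
     J a0 t = J a1 t \<and> J b0 t = J b1 t \<and>
     mono_on {..a0} (\<lambda>s. x s t) \<and> mono_on {a1..b0} (\<lambda>s. x s t) \<and> mono_on {b1..} (\<lambda>s. x s t) \<and>
     (\<forall>s. s < a0 \<or> b1 < s \<longrightarrow> v (x s t) = g s)"

lemma two_cuts_ordered:
  assumes "t > 0" and curve: "equal_area_curve x g t {(a0, a1), (b0, b1)} v" and "a1 \<le> b0"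
  shows "two_cuts t v a0 a1 b0 b1"
proof -
  note pair = equal_area_curve_pair[OF curve \<open>t > 0\<close>]
  have a: "a0 < a1" "x a0 t = x a1 t" "J a0 t = J a1 t"
    and b: "b0 < b1" "x b0 t = x b1 t" "J b0 t = J b1 t"
    using pair by simp_all
  have inj: "(s = a0 \<and> s' = a1) \<or> (s = b0 \<and> s' = b1)"
    if "x s t = x s' t" "s < s'" "s \<notin> {a0<..<a1} \<union> {b0<..<b1}" "s' \<notin> {a0<..<a1} \<union> {b0<..<b1}" for s s'
    using same_x_outside_cuts[OF curve \<open>t > 0\<close> _ that(1,2)] that(3,4) by blast
  have left: "strict_mono_on {..a0} (\<lambda>s. x s t)"
  proof (rule inj_ray_strict_mono[OF \<open>t > 0\<close>], rule linorder_inj_onI')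
    fix s s' assume "s \<in> {..a0}" "s' \<in> {..a0}" "s < s'"
    then show "x s t \<noteq> x s' t"
      using inj[of s s'] a b \<open>a1 \<le> b0\<close> by auto
  qed simp
  have right: "strict_mono_on {b1..} (\<lambda>s. x s t)"
  proof (rule inj_ray_strict_mono[OF \<open>t > 0\<close>], rule linorder_inj_onI')
    fix s s' assume "s \<in> {b1..}" "s' \<in> {b1..}" "s < s'"
    then show "x s t \<noteq> x s' t"
      using inj[of s s'] a b \<open>a1 \<le> b0\<close> by auto
  qed simp
  have "inj_on (\<lambda>s. x s t) {a1..b0}"
  proof (rule linorder_inj_onI')
    fix s s' assume "s \<in> {a1..b0}" "s' \<in> {a1..b0}" "s < s'"
    then show "x s t \<noteq> x s' t"
      using inj[of s s'] a b \<open>a1 \<le> b0\<close> by auto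
  qed
  then have dichotomy: "strict_mono_on {a1..b0} (\<lambda>s. x s t) \<or> strict_antimono_on {a1..b0} (\<lambda>s. x s t)"
    using injective_eq_monotone_map[OF _ x_cont, of "{a1..b0}" t] by (simp add: is_interval_cc)
  have not_anti: "\<not> strict_antimono_on {a1..b0} (\<lambda>s. x s t)" if "a1 < b0"
  proof
    assume "strict_antimono_on {a1..b0} (\<lambda>s. x s t)"
    then have lt: "x b0 t < x a0 t"
      using that a(2) by (auto simp: monotone_on_def)
    obtain H where H: "\<And>s. \<bar>x s t - s\<bar> \<le> H * t"
      using x_displacement_bounded \<open>t > 0\<close> less_imp_le by metis
    define r where "r = min a0 (x b0 t - H * t)"
    have "x r t \<le> r + H * t"
      using H[of r] by (simp add: abs_le_iff)
    then have "x r t \<le> x b0 t"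
      by (simp add: r_def)
    moreover have "r \<le> a0"
      by (simp add: r_def)
    ultimately obtain s where s: "r \<le> s" "s \<le> a0" "x s t = x b0 t"
      using IVT'[OF _ less_imp_le[OF lt] _ x_cont, of r] by blast
    have "s \<noteq> a0"
      using s(3) lt by auto
    then show False
      using inj[of s b0] s a b that by auto
  qed
  have "mono_on {a1..b0} (\<lambda>s. x s t)"
  proof (cases "a1 = b0")
    case True
    then show ?thesis by (simp add: monotone_on_def)
  next
    case False
    then show ?thesis
      using dichotomy not_anti \<open>a1 \<le> b0\<close> by (simp add: strict_mono_on_imp_mono_on)
  qed
  moreover have "v (x s t) = g s" if "s < a0 \<or> b1 < s" for s
    using replaced_at[OF curve \<open>t > 0\<close>, of s] that a b \<open>a1 \<le> b0\<close> by fastforce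
  ultimately show ?thesis
    unfolding two_cuts_def using a b \<open>a1 \<le> b0\<close> left right strict_mono_on_imp_mono_on by blast
qed

lemma two_cuts_exist:
  assumes "t > 0" and curve: "equal_area_curve x g t {(a0, a1), (b0, b1)} v" and "x a0 t \<noteq> x b0 t"
  shows "two_cuts t v a0 a1 b0 b1 \<or> two_cuts t v b0 b1 a0 a1"
proof -
  have lt: "a0 < a1" "b0 < b1"
    using equal_area_curve_pair(1)[OF curve \<open>t > 0\<close>] by simp_all
  have "(a0, a1) \<noteq> (b0, b1)"
    using assms(3) by auto
  then have "{a0<..<a1} \<inter> {b0<..<b1} = {}"
    using curve lt unfolding equal_area_curve_def by (fastforce simp: open_segment_eq_real_ivl)
  then have "a1 \<le> b0 \<or> b1 \<le> a0"
  proof (rule contrapos_pp)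
    assume "\<not> (a1 \<le> b0 \<or> b1 \<le> a0)"
    then have "max a0 b0 < min a1 b1"
      using lt by auto
    then obtain z where "max a0 b0 < z" "z < min a1 b1"
      using dense by blast
    then have "z \<in> {a0<..<a1} \<inter> {b0<..<b1}"
      by simp
    then show "{a0<..<a1} \<inter> {b0<..<b1} \<noteq> {}"
      by blast
  qed
  moreover have "equal_area_curve x g t {(b0, b1), (a0, a1)} v"
    using curve by (simp add: insert_commute)
  ultimately show ?thesis
    using two_cuts_ordered[OF \<open>t > 0\<close>] curve by blast
qed

section \<open>Passage to the collision time\<close>

lemma mono_on_limit:
  assumes t: "t \<longlonglongrightarrow> tc" and mono: "\<And>n. mono_on (I n) (\<lambda>s. x s (t n))"
    and clip: "\<And>n u. clip n u \<in> I n" "\<And>n. mono (clip n)" "\<And>u. u \<in> I' \<Longrightarrow> (\<lambda>n. clip n u) \<longlonglongrightarrow> u"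
  shows "mono_on I' (\<lambda>s. x s tc)"
proof (rule mono_onI)
  fix s s' assume s: "s \<in> I'" "s' \<in> I'" "s \<le> s'"
  show "x s tc \<le> x s' tc"
  proof (rule LIMSEQ_le[OF tendsto_x[OF clip(3)[OF s(1)] t] tendsto_x[OF clip(3)[OF s(2)] t]])
    have "x (clip n s) (t n) \<le> x (clip n s') (t n)" for n
      using mono_onD[OF mono clip(1,1)] monoD[OF clip(2) s(3)] .
    then show "\<exists>N. \<forall>n\<ge>N. x (clip n s) (t n) \<le> x (clip n s') (t n)"
      by blast
  qed
qed

lemma two_cuts_limit:
  assumes t: "t \<longlonglongrightarrow> tc" "\<And>n. 0 < t n" "\<And>n. t n < tc"
    and cuts: "\<And>n. two_cuts (t n) (v n) (a0 n) (a1 n) (b0 n) (b1 n)"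
    and xa: "(\<lambda>n. x (a0 n) (t n)) \<longlonglongrightarrow> X" and xb: "(\<lambda>n. x (b0 n) (t n)) \<longlonglongrightarrow> X"
  obtains r A B where "strict_mono r" "(a0 \<circ> r) \<longlonglongrightarrow> A" "(b1 \<circ> r) \<longlonglongrightarrow> B" "A < B"
    "x A tc = X" "x B tc = X" "J A tc = J B tc"
    "mono_on {..A} (\<lambda>s. x s tc)" "mono_on {B..} (\<lambda>s. x s tc)"
proof -
  note cuts' = cuts[unfolded two_cuts_def]
  obtain H where H: "H > 0" "\<And>s t. t \<ge> 0 \<Longrightarrow> \<bar>x s t - s\<bar> \<le> H * t"
    using x_displacement_bounded by blast
  have bdd: "bounded (range s)" if "bounded (range (\<lambda>n. x (s n) (t n)))" for s
  proof -
    have "\<exists>C. \<forall>n. \<bar>x (s n) (t n)\<bar> \<le> C"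
      using that by (auto simp: bounded_iff)
    then obtain C where C: "\<And>n. \<bar>x (s n) (t n)\<bar> \<le> C"
      by blast
    have "\<bar>s n\<bar> \<le> C + H * tc" for n
    proof -
      have "H * t n \<le> H * tc"
        using t(3)[of n] H(1) by simp
      then show ?thesis
        using C[of n] H(2)[of "t n" "s n"] t(2)[of n] by linarith
    qed
    then show ?thesis
      by (auto simp: bounded_iff)
  qed
  have "bounded (range (\<lambda>n. x (a0 n) (t n)))" "bounded (range (\<lambda>n. x (b0 n) (t n)))"
    using xa xb by (auto intro: convergent_imp_bounded)
  then have "bounded (range a0)" "bounded (range a1)" "bounded (range b0)" "bounded (range b1)"
    using bdd[of a0] bdd[of a1] bdd[of b0] bdd[of b1] cuts' by simp_all
  then have "bounded (range a0 \<times> range a1 \<times> range b0 \<times> range b1)"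
    by (intro bounded_Times)
  then have "bounded (range (\<lambda>n. (a0 n, a1 n, b0 n, b1 n)))"
    by (rule bounded_subset) auto
  then obtain L r where r: "strict_mono r" "((\<lambda>n. (a0 n, a1 n, b0 n, b1 n)) \<circ> r) \<longlonglongrightarrow> L"
    using bounded_imp_convergent_subsequence by blast
  obtain A0 A1 B0 B1 where L: "L = (A0, A1, B0, B1)"
    by (cases L) auto
  have lim: "(\<lambda>n. a0 (r n)) \<longlonglongrightarrow> A0" "(\<lambda>n. a1 (r n)) \<longlonglongrightarrow> A1"
    "(\<lambda>n. b0 (r n)) \<longlonglongrightarrow> B0" "(\<lambda>n. b1 (r n)) \<longlonglongrightarrow> B1"
    using tendsto_fst[OF r(2)] tendsto_fst[OF tendsto_snd[OF r(2)]]
      tendsto_fst[OF tendsto_snd[OF tendsto_snd[OF r(2)]]]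
      tendsto_snd[OF tendsto_snd[OF tendsto_snd[OF r(2)]]]
    by (simp_all add: L comp_def)
  have tr: "(\<lambda>n. t (r n)) \<longlonglongrightarrow> tc"
    using LIMSEQ_subseq_LIMSEQ[OF t(1) r(1)] by (simp add: comp_def)
  have xr: "(\<lambda>n. x (a0 (r n)) (t (r n))) \<longlonglongrightarrow> X" "(\<lambda>n. x (b0 (r n)) (t (r n))) \<longlonglongrightarrow> X"
    using LIMSEQ_subseq_LIMSEQ[OF xa r(1)] LIMSEQ_subseq_LIMSEQ[OF xb r(1)] by (simp_all add: comp_def)
  have A0: "x A0 tc = X"
    using LIMSEQ_unique[OF tendsto_x[OF lim(1) tr] xr(1)] .
  have B0: "x B0 tc = X"
    using LIMSEQ_unique[OF tendsto_x[OF lim(3) tr] xr(2)] .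
  have A1: "x A1 tc = X"
    using LIMSEQ_unique[OF tendsto_x[OF lim(2) tr]] xr(1) cuts' by simp
  have B1: "x B1 tc = X"
    using LIMSEQ_unique[OF tendsto_x[OF lim(4) tr]] xr(2) cuts' by simp
  have JA: "J A0 tc = J A1 tc"
    using LIMSEQ_unique[OF tendsto_J[OF lim(1) tr]] tendsto_J[OF lim(2) tr] cuts' by simp
  have JB: "J B0 tc = J B1 tc"
    using LIMSEQ_unique[OF tendsto_J[OF lim(3) tr]] tendsto_J[OF lim(4) tr] cuts' by simp
  have ord: "A0 \<le> A1" "A1 \<le> B0" "B0 \<le> B1"
    using LIMSEQ_le[OF lim(1,2)] LIMSEQ_le[OF lim(2,3)] LIMSEQ_le[OF lim(3,4)] cuts'
    by (meson less_imp_le)+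
  have left: "mono_on {..A0} (\<lambda>s. x s tc)"
  proof (rule mono_on_limit[OF tr])
    show "mono_on {..a0 (r n)} (\<lambda>s. x s (t (r n)))" for n
      using cuts' by blast
    show "(\<lambda>n. min u (a0 (r n))) \<longlonglongrightarrow> u" if "u \<in> {..A0}" for u
      using tendsto_min[OF tendsto_const lim(1), of u] that by (simp add: min_absorb1)
  qed (auto intro!: monoI min.mono)
  have right: "mono_on {B1..} (\<lambda>s. x s tc)"
  proof (rule mono_on_limit[OF tr])
    show "mono_on {b1 (r n)..} (\<lambda>s. x s (t (r n)))" for n
      using cuts' by blast
    show "(\<lambda>n. max u (b1 (r n))) \<longlonglongrightarrow> u" if "u \<in> {B1..}" for u
      using tendsto_max[OF tendsto_const lim(4), of u] that by (simp add: max_absorb1)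
  qed (auto intro!: monoI max.mono)
  have middle: "mono_on {A1..B0} (\<lambda>s. x s tc)"
  proof (rule mono_on_limit[OF tr])
    show "mono_on {a1 (r n)..b0 (r n)} (\<lambda>s. x s (t (r n)))" for n
      using cuts' by blast
    show "(\<lambda>n. max (a1 (r n)) (min u (b0 (r n)))) \<longlonglongrightarrow> u" if "u \<in> {A1..B0}" for u
      using tendsto_max[OF lim(2) tendsto_min[OF tendsto_const lim(3), of u]] that
      by (simp add: min_absorb1 max_absorb2)
    show "max (a1 (r n)) (min u (b0 (r n))) \<in> {a1 (r n)..b0 (r n)}" for n u
      using cuts'[of "r n"] by auto
  qed (auto intro!: monoI max.mono min.mono)
  have "J A1 tc = J B0 tc"
    using J_mean_value[OF ord(2) middle] A1 B0 by auto
  moreover have "A0 < B1"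
  proof (rule ccontr)
    assume "\<not> A0 < B1"
    then have eq: "A0 = B1"
      using ord by simp
    have "x (a0 0) tc \<le> x (a1 0) tc"
    proof -
      have "x s tc \<le> x s' tc" if "s \<le> s'" for s s'
        using mono_onD[OF left, of s s'] mono_onD[OF right, of s s']
          mono_onD[OF left, of s A0] mono_onD[OF right, of A0 s'] that eq
        by (cases "s' \<le> A0"; cases "A0 \<le> s") auto
      then show ?thesis
        using cuts'[of 0] by (simp add: less_imp_le)
    qed
    then have "a0 0 + h (a0 0) * tc \<le> a1 0 + h (a1 0) * tc"
      by (simp add: x_eq)
    moreover have "a0 0 + h (a0 0) * t 0 = a1 0 + h (a1 0) * t 0"
      using cuts'[of 0] by (simp add: x_eq)
    ultimately have "a1 0 - a0 0 \<ge> (h (a0 0) - h (a1 0)) * tc" "a1 0 - a0 0 = (h (a0 0) - h (a1 0)) * t 0"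
      by (simp_all add: algebra_simps)
    moreover have "a1 0 - a0 0 > 0"
      using cuts'[of 0] by simp
    ultimately show False
      using t(2,3)[of 0] by (smt (verit) mult_less_cancel_left mult_nonneg_nonneg zero_less_mult_iff)
  qed
  ultimately show thesis
    using that[of r A0 B1] r(1) lim(1,4) A0 B1 JA JB left right by (simp add: comp_def)
qed

text \<open>\<open>trace_on t v S\<close> is what survives of \<open>v (x s t) = g s\<close> under an \<open>L1\<close> limit.\<close>

definition trace_on :: "real \<Rightarrow> (real \<Rightarrow> real) \<Rightarrow> real set \<Rightarrow> bool" where
  "trace_on t v S \<longleftrightarrow> (\<forall>p q k e Y. p < q \<longrightarrow> {p..q} \<subseteq> S \<longrightarrow> (\<forall>s\<in>{p..q}. \<bar>g s - k\<bar> \<le> e) \<longrightarrow>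
     Y \<in> {x p t<..<x q t} \<longrightarrow> \<bar>v Y - k\<bar> \<le> e)"

lemma trace_onD:
  assumes "trace_on t v S" and "p < q" and "{p..q} \<subseteq> S" and "\<And>s. s \<in> {p..q} \<Longrightarrow> \<bar>g s - k\<bar> \<le> e"
    and "Y \<in> {x p t<..<x q t}"
  shows "\<bar>v Y - k\<bar> \<le> e"
  using assms(1)[unfolded trace_on_def, rule_format, OF assms(2,3) _ assms(5)] assms(4) by blast

lemma trace_right:
  assumes trace: "trace_on t v S" and "open S" and "q \<in> S" and cont: "isCont v (x q t)"
    and gt: "\<And>r. r > q \<Longrightarrow> r \<in> S \<Longrightarrow> x r t > x q t"
  shows "v (x q t) = g q"
proof -
  have "\<bar>v (x q t) - g q\<bar> \<le> e" if "e > 0" for e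
  proof -
    have "isCont g q"
      using g_cont by (simp add: continuous_on_eq_continuous_at)
    then obtain d1 where d1: "d1 > 0" "\<And>s. dist s q < d1 \<Longrightarrow> dist (g s) (g q) < e"
      using \<open>e > 0\<close> unfolding continuous_at_eps_delta dist_real_def by blast
    obtain d2 where d2: "d2 > 0" "ball q d2 \<subseteq> S"
      using \<open>open S\<close> \<open>q \<in> S\<close> openE by blast
    define r where "r = q + min d1 d2 / 2"
    have r: "q < r" "r < q + d1" "r < q + d2"
      using d1(1) d2(1) by (auto simp: r_def min_def)
    have sub: "{q..r} \<subseteq> S"
      using r(3) d2(2) by (intro subset_trans[OF _ d2(2)]) (auto simp: dist_real_def)
    have "r \<in> S"
      using sub r(1) by auto
    then have "x r t > x q t"
      using gt r(1) by blast
    moreover have "\<bar>v Y - g q\<bar> \<le> e" if "Y \<in> {x q t<..<x r t}" for Y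
    proof (rule trace_onD[OF trace r(1) sub _ that])
      show "\<bar>g s - g q\<bar> \<le> e" if "s \<in> {q..r}" for s
        using d1(2)[of s] r(2) that by (auto simp: dist_real_def)
    qed
    ultimately have "eventually (\<lambda>Y. \<bar>v Y - g q\<bar> \<le> e) (at_right (x q t))"
      unfolding eventually_at_right_field by auto
    moreover have "((\<lambda>Y. \<bar>v Y - g q\<bar>) \<longlongrightarrow> \<bar>v (x q t) - g q\<bar>) (at_right (x q t))"
      using cont by (intro tendsto_intros) (simp add: isCont_def filterlim_at_split)
    ultimately show ?thesis
      by (intro tendsto_upperbound) auto
  qed
  then have "\<bar>v (x q t) - g q\<bar> \<le> 0"
    by (rule field_le_epsilon) simp
  then show ?thesis by simp
qed

lemma trace_left:
  assumes trace: "trace_on t v S" and "open S" and "q \<in> S" and cont: "isCont v (x q t)"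
    and gt: "\<And>r. r < q \<Longrightarrow> r \<in> S \<Longrightarrow> x r t < x q t"
  shows "v (x q t) = g q"
proof -
  have "\<bar>v (x q t) - g q\<bar> \<le> e" if "e > 0" for e
  proof -
    have "isCont g q"
      using g_cont by (simp add: continuous_on_eq_continuous_at)
    then obtain d1 where d1: "d1 > 0" "\<And>s. dist s q < d1 \<Longrightarrow> dist (g s) (g q) < e"
      using \<open>e > 0\<close> unfolding continuous_at_eps_delta dist_real_def by blast
    obtain d2 where d2: "d2 > 0" "ball q d2 \<subseteq> S"
      using \<open>open S\<close> \<open>q \<in> S\<close> openE by blast
    define r where "r = q - min d1 d2 / 2"
    have r: "r < q" "q - d1 < r" "q - d2 < r"
      using d1(1) d2(1) by (auto simp: r_def min_def)
    have sub: "{r..q} \<subseteq> S"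
      using r(3) d2(2) by (intro subset_trans[OF _ d2(2)]) (auto simp: dist_real_def)
    have "r \<in> S"
      using sub r(1) by auto
    then have "x r t < x q t"
      using gt r(1) by blast
    moreover have "\<bar>v Y - g q\<bar> \<le> e" if "Y \<in> {x r t<..<x q t}" for Y
    proof (rule trace_onD[OF trace r(1) sub _ that])
      show "\<bar>g s - g q\<bar> \<le> e" if "s \<in> {r..q}" for s
        using d1(2)[of s] r(2) that by (auto simp: dist_real_def)
    qed
    ultimately have "eventually (\<lambda>Y. \<bar>v Y - g q\<bar> \<le> e) (at_left (x q t))"
      unfolding eventually_at_left_field by auto
    moreover have "((\<lambda>Y. \<bar>v Y - g q\<bar>) \<longlongrightarrow> \<bar>v (x q t) - g q\<bar>) (at_left (x q t))"
      using cont by (intro tendsto_intros) (simp add: isCont_def filterlim_at_split)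
    ultimately show ?thesis
      by (intro tendsto_upperbound) auto
  qed
  then have "\<bar>v (x q t) - g q\<bar> \<le> 0"
    by (rule field_le_epsilon) simp
  then show ?thesis by simp
qed

lemma level_set_compact:
  assumes "t > 0" and "closed C"
  shows "compact {r \<in> C. x r t = Y}"
proof -
  obtain H where H: "\<And>s t. t \<ge> 0 \<Longrightarrow> \<bar>x s t - s\<bar> \<le> H * t"
    using x_displacement_bounded by blast
  have "{r \<in> C. x r t = Y} = C \<inter> (\<lambda>r. x r t) -` {Y}"
    by auto
  then have "closed {r \<in> C. x r t = Y}"
    using assms(2) continuous_closed_preimage[OF x_cont assms(2) closed_singleton] by simp
  moreover have "{r \<in> C. x r t = Y} \<subseteq> {Y - H * t..Y + H * t}"
  proof
    fix r assume "r \<in> {r \<in> C. x r t = Y}"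
    then show "r \<in> {Y - H * t..Y + H * t}"
      using H[of t r] \<open>t > 0\<close> by auto
  qed
  ultimately show ?thesis
    using bounded_subset[OF bounded_closed_interval] by (simp add: compact_eq_bounded_closed)
qed

text \<open>A continuous \<open>v\<close> takes at the level \<open>x s t\<close> both the values of \<open>g\<close> at the first and at the last
  point of the level set; as \<open>g\<close> is injective on level sets, there is only one point.\<close>

lemma trace_eq:
  assumes "t > 0" and trace: "trace_on t v S" and "open S" "closed C" "S \<subseteq> C"
    and bd: "\<And>r. r \<in> C \<Longrightarrow> r \<notin> S \<Longrightarrow> x r t = X"
    and mono: "mono_on C (\<lambda>s. x s t)" and cont: "\<And>Y. Y \<noteq> X \<Longrightarrow> isCont v Y"
    and "s \<in> C" "x s t \<noteq> X"
  shows "v (x s t) = g s"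
proof -
  let ?L = "{r \<in> C. x r t = x s t}"
  have L: "compact ?L" "?L \<noteq> {}"
    using level_set_compact[OF \<open>t > 0\<close> \<open>closed C\<close>] \<open>s \<in> C\<close> by auto
  obtain q where q: "q \<in> ?L" "\<And>r. r \<in> ?L \<Longrightarrow> r \<le> q"
    using compact_attains_sup[OF L] by blast
  obtain p where p: "p \<in> ?L" "\<And>r. r \<in> ?L \<Longrightarrow> p \<le> r"
    using compact_attains_inf[OF L] by blast
  have "v (x q t) = g q"
  proof (rule trace_right[OF trace \<open>open S\<close>])
    show "q \<in> S"
      using q(1) bd[of q] \<open>x s t \<noteq> X\<close> by auto
    show "isCont v (x q t)"
      using q(1) cont \<open>x s t \<noteq> X\<close> by auto
    show "x r t > x q t" if "r > q" "r \<in> S" for r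
      using mono_onD[OF mono, of q r] q(1) q(2)[of r] that \<open>S \<subseteq> C\<close> by force
  qed
  moreover have "v (x p t) = g p"
  proof (rule trace_left[OF trace \<open>open S\<close>])
    show "p \<in> S"
      using p(1) bd[of p] \<open>x s t \<noteq> X\<close> by auto
    show "isCont v (x p t)"
      using p(1) cont \<open>x s t \<noteq> X\<close> by auto
    show "x r t < x p t" if "r < p" "r \<in> S" for r
      using mono_onD[OF mono, of r p] p(1) p(2)[of r] that \<open>S \<subseteq> C\<close> by force
  qed
  ultimately have "g p = g q"
    using p(1) q(1) by simp
  then have "p = q"
    using same_x_same_g[OF _ \<open>t > 0\<close>] p(1) q(1) by auto
  then have "s = q"
    using p(2)[of s] q(2)[of s] \<open>s \<in> C\<close> by auto
  then show ?thesis
    using \<open>v (x q t) = g q\<close> by simp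
qed

lemma trace_on_limit:
  fixes a b :: "nat \<Rightarrow> real" and f :: "nat \<Rightarrow> real \<Rightarrow> real"
  assumes t: "t \<longlonglongrightarrow> tc"
    and v: "\<And>n s. s < a n \<or> b n < s \<Longrightarrow> v n (x s (t n)) = g s"
    and ab: "a \<longlonglongrightarrow> A" "b \<longlonglongrightarrow> B"
    and meas: "\<And>n. f n \<in> borel_measurable lebesgue" "f' \<in> borel_measurable lebesgue"
    and bdd: "\<And>n. AE X in lebesgue. \<bar>f n X\<bar> \<le> M'" "AE X in lebesgue. \<bar>f' X\<bar> \<le> M'"
    and L1: "\<And>R. R > 0 \<Longrightarrow> (\<lambda>n. LINT X:{-R..R}|lebesgue. \<bar>f n X - f' X\<bar>) \<longlonglongrightarrow> 0"
    and fv: "\<And>n. AE X in lebesgue. f n X = v n X" "AE X in lebesgue. f' X = v' X"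
    and cont: "continuous_on (- {X0}) v'"
    and S: "S = {..<A} \<and> (\<forall>s\<in>S. x s tc \<le> X0) \<or> S = {B<..} \<and> (\<forall>s\<in>S. X0 \<le> x s tc)"
  shows "trace_on tc v' S"
  unfolding trace_on_def
proof (intro allI impI)
  fix p q k e Y
  assume "p < q" and pq: "{p..q} \<subseteq> S" and close: "\<forall>s\<in>{p..q}. \<bar>g s - k\<bar> \<le> e"
    and Y: "Y \<in> {x p tc<..<x q tc}"
  obtain \<alpha> \<beta> where \<alpha>\<beta>: "x p tc < \<alpha>" "\<alpha> < Y" "Y < \<beta>" "\<beta> < x q tc"
    using Y dense[of "x p tc" Y] dense[of Y "x q tc"] by auto
  have "p \<in> S" "q \<in> S"
    using pq \<open>p < q\<close> by auto
  have "eventually (\<lambda>n. x p (t n) < \<alpha>) sequentially" "eventually (\<lambda>n. \<beta> < x q (t n)) sequentially"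
    using order_tendstoD[OF tendsto_x[OF tendsto_const t]] \<alpha>\<beta> by blast+
  moreover have "eventually (\<lambda>n. q < a n \<or> b n < p) sequentially"
    using S
  proof
    assume "S = {..<A} \<and> (\<forall>s\<in>S. x s tc \<le> X0)"
    then have "q < A" using \<open>q \<in> S\<close> by auto
    from order_tendstoD(1)[OF ab(1) this] show ?thesis
      by eventually_elim simp
  next
    assume "S = {B<..} \<and> (\<forall>s\<in>S. X0 \<le> x s tc)"
    then have "B < p" using \<open>p \<in> S\<close> by auto
    from order_tendstoD(2)[OF ab(2) this] show ?thesis
      by eventually_elim simp
  qed
  ultimately have ev: "eventually (\<lambda>n. AE X in lebesgue. X \<in> {\<alpha><..<\<beta>} \<longrightarrow> \<bar>f n X - k\<bar> \<le> e) sequentially"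
  proof eventually_elim
    case (elim n)
    show ?case
      using fv(1)[of n]
    proof eventually_elim
      case (elim X)
      show ?case
      proof
        assume "X \<in> {\<alpha><..<\<beta>}"
        then have "x p (t n) \<le> X" "X \<le> x q (t n)"
          using \<open>x p (t n) < \<alpha>\<close> \<open>\<beta> < x q (t n)\<close> by auto
        then obtain s where s: "p \<le> s" "s \<le> q" "x s (t n) = X"
          using IVT'[OF _ _ less_imp_le[OF \<open>p < q\<close>] x_cont] by blast
        then have "s < a n \<or> b n < s"
          using \<open>q < a n \<or> b n < p\<close> by auto
        then have "v n X = g s"
          using v s(3) by blast
        then show "\<bar>f n X - k\<bar> \<le> e"
          using elim close s by auto
      qed
    qed
  qed
  define R where "R = max \<bar>\<alpha>\<bar> \<bar>\<beta>\<bar> + 1"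
  have "R > 0" "{\<alpha><..<\<beta>} \<subseteq> {-R..R}"
    by (auto simp: R_def)
  have "AE X in lebesgue. X \<in> {\<alpha><..<\<beta>} \<longrightarrow> \<bar>f' X - k\<bar> \<le> e"
    by (rule L1_limit_AE_bound[OF meas bdd L1[OF \<open>R > 0\<close>] \<open>{\<alpha><..<\<beta>} \<subseteq> _\<close> _ ev]) simp
  then have ae: "AE X in lebesgue. X \<in> {\<alpha><..<\<beta>} \<longrightarrow> \<bar>v' X - k\<bar> \<le> e"
    using fv(2) by eventually_elim simp
  have v'_cont: "continuous_on {\<alpha><..<\<beta>} v'"
  proof (rule continuous_on_subset[OF cont])
    have "x p tc \<ge> X0 \<or> x q tc \<le> X0"
      using S \<open>p \<in> S\<close> \<open>q \<in> S\<close> by blast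
    then show "{\<alpha><..<\<beta>} \<subseteq> - {X0}"
      using \<alpha>\<beta> by auto
  qed
  show "\<bar>v' Y - k\<bar> \<le> e"
    using AE_bound_imp_bound[OF open_greaterThanLessThan v'_cont ae] \<alpha>\<beta> by simp
qed

text \<open>By the chain rule \<open>g' = v' \<cdot> x\<^sub>s\<close>, so \<open>x\<^sub>s\<close> could only tend to \<open>0\<close> together with \<open>g'\<close>; but then
  \<open>x\<^sub>s = 1 + F'' g' t\<close> tends to \<open>1\<close>.\<close>

lemma deriv_x_limit_pos:
  assumes "\<F> \<le> at s0" "\<F> \<noteq> bot" and g': "(deriv g \<longlongrightarrow> \<gamma>) \<F>"
    and v': "((\<lambda>s. deriv v (x s t)) \<longlongrightarrow> \<nu>) \<F>"
    and chain: "eventually (\<lambda>s. deriv g s = deriv v (x s t) * deriv (\<lambda>r. x r t) s) \<F>"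
    and nonneg: "eventually (\<lambda>s. deriv (\<lambda>r. x r t) s \<ge> 0) \<F>"
  shows "\<exists>l>0. (deriv (\<lambda>r. x r t) \<longlongrightarrow> l) \<F>"
proof -
  let ?l = "1 + deriv (deriv F) (g s0) * \<gamma> * t"
  have lim: "(deriv (\<lambda>r. x r t) \<longlongrightarrow> ?l) \<F>"
    by (rule deriv_x_tendsto[OF g' assms(1)])
  have "((\<lambda>s. deriv v (x s t) * deriv (\<lambda>r. x r t) s) \<longlongrightarrow> \<nu> * ?l) \<F>"
    by (intro tendsto_intros v' lim)
  then have "(deriv g \<longlongrightarrow> \<nu> * ?l) \<F>"
    using chain by (simp cong: tendsto_cong)
  then have "\<gamma> = \<nu> * ?l"
    using tendsto_unique[OF assms(2) g'] by blast
  moreover have "?l \<ge> 0"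
    using tendsto_lowerbound[OF lim nonneg] assms(2) by simp
  ultimately have "?l > 0"
    by (cases "?l = 0") auto
  then show ?thesis
    using lim by blast
qed

lemma chain_rule_at:
  assumes "open U" "s \<in> U" "\<And>r. r \<in> U \<Longrightarrow> v (x r t) = g r"
    and "(v has_real_derivative deriv v (x s t)) (at (x s t))" and "s \<notin> D"
  shows "deriv g s = deriv v (x s t) * deriv (\<lambda>r. x r t) s"
proof -
  have "((\<lambda>r. v (x r t)) has_real_derivative deriv v (x s t) * deriv (\<lambda>r. x r t) s) (at s)"
    by (rule DERIV_chain2[OF assms(4) x_deriv[OF assms(5)]])
  then have "(g has_real_derivative deriv v (x s t) * deriv (\<lambda>r. x r t) s) (at s)"
    by (rule has_field_derivative_transform_within_open[OF _ assms(1,2)]) (use assms(3) in auto)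
  then show ?thesis
    by (rule DERIV_imp_deriv)
qed

lemma deriv_x_left_pos:
  assumes mono: "strict_mono_on {..s0} (\<lambda>s. x s t)" and v: "piecewise_C1 v"
    and vg: "\<And>s. s < s0 \<Longrightarrow> v (x s t) = g s"
  shows "\<exists>l>0. (deriv (\<lambda>r. x r t) \<longlongrightarrow> l) (at_left s0)"
proof -
  obtain \<gamma> where \<gamma>: "(deriv g \<longlongrightarrow> \<gamma>) (at_left s0)"
    using piecewise_C1_one_sided_limits(2)[OF g_pw, of s0] unfolding has_one_sided_limits_def by blast
  obtain \<nu> where \<nu>: "(deriv v \<longlongrightarrow> \<nu>) (at_left (x s0 t))"
    using piecewise_C1_one_sided_limits(2)[OF v, of "x s0 t"] unfolding has_one_sided_limits_def by blast
  have left: "eventually (\<lambda>s. s < s0) (at_left s0)"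
    by (simp add: eventually_at_filter)
  have "((\<lambda>s. x s t) \<longlongrightarrow> x s0 t) (at_left s0)"
    by (rule tendsto_x) (auto intro: tendsto_ident_at)
  moreover have "s < s0 \<Longrightarrow> x s t < x s0 t \<and> x s t \<noteq> x s0 t" for s
    using strict_mono_onD[OF mono, of s s0] by force
  ultimately have lim: "filterlim (\<lambda>s. x s t) (at_left (x s0 t)) (at_left s0)"
    unfolding filterlim_at by (auto intro!: eventually_mono[OF left])
  have notin: "eventually (\<lambda>s. s \<notin> D) (at_left s0)"
    using eventually_notin_D[of s0] by (simp add: eventually_at_split)
  have diff: "eventually (\<lambda>s. (v has_real_derivative deriv v (x s t)) (at (x s t))) (at_left s0)"
    by (rule eventually_compose_filterlim[OF _ lim])
      (use piecewise_C1_eventually_differentiable[OF v, of "x s0 t"] in \<open>simp add: eventually_at_split\<close>)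
  show ?thesis
  proof (rule deriv_x_limit_pos[where ?s0.0 = s0, OF _ _ \<gamma> filterlim_compose[OF \<nu> lim]])
    show "eventually (\<lambda>s. deriv g s = deriv v (x s t) * deriv (\<lambda>r. x r t) s) (at_left s0)"
      using left notin diff by eventually_elim (use vg in \<open>auto intro!: chain_rule_at[of "{..<s0}"]\<close>)
    show "eventually (\<lambda>s. 0 \<le> deriv (\<lambda>r. x r t) s) (at_left s0)"
      using left notin
    proof eventually_elim
      case (elim s)
      then show ?case
        using mono by (intro deriv_x_nonneg[of "s - 1" s0 t s])
          (auto intro: strict_mono_on_imp_mono_on monotone_on_subset)
    qed
  qed (auto simp: at_le)
qed

lemma deriv_x_right_pos:
  assumes mono: "strict_mono_on {s0..} (\<lambda>s. x s t)" and v: "piecewise_C1 v"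
    and vg: "\<And>s. s > s0 \<Longrightarrow> v (x s t) = g s"
  shows "\<exists>l>0. (deriv (\<lambda>r. x r t) \<longlongrightarrow> l) (at_right s0)"
proof -
  obtain \<gamma> where \<gamma>: "(deriv g \<longlongrightarrow> \<gamma>) (at_right s0)"
    using piecewise_C1_one_sided_limits(2)[OF g_pw, of s0] unfolding has_one_sided_limits_def by blast
  obtain \<nu> where \<nu>: "(deriv v \<longlongrightarrow> \<nu>) (at_right (x s0 t))"
    using piecewise_C1_one_sided_limits(2)[OF v, of "x s0 t"] unfolding has_one_sided_limits_def by blast
  have right: "eventually (\<lambda>s. s > s0) (at_right s0)"
    by (simp add: eventually_at_filter)
  have "((\<lambda>s. x s t) \<longlongrightarrow> x s0 t) (at_right s0)"
    by (rule tendsto_x) (auto intro: tendsto_ident_at)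
  moreover have "s > s0 \<Longrightarrow> x s t > x s0 t \<and> x s t \<noteq> x s0 t" for s
    using strict_mono_onD[OF mono, of s0 s] by force
  ultimately have lim: "filterlim (\<lambda>s. x s t) (at_right (x s0 t)) (at_right s0)"
    unfolding filterlim_at by (auto intro!: eventually_mono[OF right])
  have notin: "eventually (\<lambda>s. s \<notin> D) (at_right s0)"
    using eventually_notin_D[of s0] by (simp add: eventually_at_split)
  have diff: "eventually (\<lambda>s. (v has_real_derivative deriv v (x s t)) (at (x s t))) (at_right s0)"
    by (rule eventually_compose_filterlim[OF _ lim])
      (use piecewise_C1_eventually_differentiable[OF v, of "x s0 t"] in \<open>simp add: eventually_at_split\<close>)
  show ?thesis
  proof (rule deriv_x_limit_pos[where ?s0.0 = s0, OF _ _ \<gamma> filterlim_compose[OF \<nu> lim]])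
    show "eventually (\<lambda>s. deriv g s = deriv v (x s t) * deriv (\<lambda>r. x r t) s) (at_right s0)"
      using right notin diff by eventually_elim (use vg in \<open>auto intro!: chain_rule_at[of "{s0<..}"]\<close>)
    show "eventually (\<lambda>s. 0 \<le> deriv (\<lambda>r. x r t) s) (at_right s0)"
      using right notin
    proof eventually_elim
      case (elim s)
      then show ?case
        using mono by (intro deriv_x_nonneg[of s0 "s + 1" t s])
          (auto intro: strict_mono_on_imp_mono_on monotone_on_subset)
    qed
  qed (auto simp: at_le)
qed

section \<open>Propagation of a shock\<close>

lemma deriv_x_locally_bounded_below:
  assumes "t0 > 0" and "\<F> \<le> at s0" and "l > 0" and lim: "(deriv (\<lambda>r. x r t0) \<longlongrightarrow> l) \<F>"
  shows "\<exists>m>0. \<exists>\<epsilon>>0. eventually (\<lambda>s. s \<notin> D \<and> (\<forall>t\<in>{t0..<t0 + \<epsilon>}. deriv (\<lambda>r. x r t) s \<ge> m)) \<F>"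
proof -
  define B where "B = (3 * l / 2 + 1) / t0"
  define \<epsilon> where "\<epsilon> = l / 4 / B"
  have B: "B > 0" using assms(1,3) by (simp add: B_def)
  then have \<epsilon>: "\<epsilon> > 0" "B * \<epsilon> = l / 4" using assms(3) by (simp_all add: \<epsilon>_def)
  have "eventually (\<lambda>s. dist (deriv (\<lambda>r. x r t0) s) l < l / 2) \<F>"
    using lim assms(3) by (intro tendstoD) auto
  moreover have "eventually (\<lambda>s. s \<notin> D) \<F>"
    using filter_leD[OF assms(2) eventually_notin_D] .
  ultimately have "eventually (\<lambda>s. s \<notin> D \<and> (\<forall>t\<in>{t0..<t0 + \<epsilon>}. deriv (\<lambda>r. x r t) s \<ge> l / 4)) \<F>"
  proof eventually_elim
    case (elim s)
    define \<kappa> where "\<kappa> = deriv (deriv F) (g s) * deriv g s"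
    have \<kappa>: "deriv (\<lambda>r. x r t) s = 1 + \<kappa> * t" for t
      using deriv_x_eq[OF \<open>s \<notin> D\<close>] by (simp add: \<kappa>_def)
    have "\<bar>1 + \<kappa> * t0 - l\<bar> < l / 2"
      using elim(1) unfolding \<kappa> dist_real_def .
    then have near: "l / 2 < 1 + \<kappa> * t0" "\<bar>\<kappa> * t0\<bar> \<le> 3 * l / 2 + 1"
      using \<open>l > 0\<close> unfolding abs_less_iff abs_le_iff by linarith+
    then have "\<bar>\<kappa>\<bar> \<le> B"
      using \<open>t0 > 0\<close> by (simp add: B_def abs_mult pos_le_divide_eq)
    have "l / 4 \<le> 1 + \<kappa> * t" if "t \<in> {t0..<t0 + \<epsilon>}" for t
    proof -
      have "\<bar>\<kappa> * (t - t0)\<bar> \<le> B * \<epsilon>"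
        unfolding abs_mult using \<open>\<bar>\<kappa>\<bar> \<le> B\<close> that B by (intro mult_mono) auto
      then have "- (l / 4) \<le> \<kappa> * (t - t0)"
        using \<epsilon>(2) by (simp add: abs_le_iff)
      moreover have "\<kappa> * t = \<kappa> * t0 + \<kappa> * (t - t0)"
        by (simp add: algebra_simps)
      ultimately show ?thesis
        using near(1) by linarith
    qed
    then show ?case
      using \<open>s \<notin> D\<close> \<kappa> by simp
  qed
  then show ?thesis
    using \<epsilon>(1) \<open>l > 0\<close> by (intro exI[of _ "l / 4"] conjI exI[of _ \<epsilon>]) auto
qed

lemma x_expansion:
  assumes good: "\<And>s. s \<in> {p<..<q} \<Longrightarrow> s \<notin> D \<and> deriv (\<lambda>r. x r t) s \<ge> m"
    and s: "s \<in> {p..q}" "s' \<in> {p..q}" "s \<le> s'"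
  shows "m * (s' - s) \<le> x s' t - x s t"
proof (cases "s = s'")
  case False
  then have "s < s'" using s by simp
  have "(\<lambda>r. x r t) differentiable (at z)" if "s < z" "z < s'" for z
  proof -
    have "z \<notin> D"
      using good[of z] s that by simp
    then show ?thesis
      using x_deriv real_differentiable_def by blast
  qed
  then obtain l z where z: "s < z" "z < s'" "DERIV (\<lambda>r. x r t) z :> l" "x s' t - x s t = (s' - s) * l"
    using MVT[OF \<open>s < s'\<close> x_cont] by blast
  then have "z \<in> {p<..<q}"
    using s by auto
  then have "l \<ge> m"
    using good DERIV_imp_deriv[OF z(3)] by auto
  then show ?thesis
    using z(4) \<open>s < s'\<close> by (simp add: mult.commute mult_left_mono)
qed simp

lemma J_mean_value_segment:
  assumes "mono_on (closed_segment p q) (\<lambda>s. x s t)"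
  shows "\<exists>\<xi>\<in>closed_segment p q. J q t - J p t = g \<xi> * (x q t - x p t)"
proof (cases "p \<le> q")
  case True
  then show ?thesis
    using J_mean_value[of p q t] assms by (simp add: closed_segment_eq_real_ivl)
next
  case False
  then obtain \<xi> where "\<xi> \<in> {q..p}" "J p t - J q t = g \<xi> * (x p t - x q t)"
    using J_mean_value[of q p t] assms by (auto simp: closed_segment_eq_real_ivl)
  then show ?thesis
    using False by (intro bexI[of _ \<xi>]) (simp_all add: closed_segment_eq_real_ivl algebra_simps)
qed

lemma J_time: "J s t' = J s t + (t' - t) * (g s * h s - F (g s))"
  by (simp add: J_def algebra_simps)

lemma x_time: "x s t' = x s t + h s * (t' - t)"
  by (simp add: x_eq algebra_simps)

end

locale shock_fan = characteristics +
  fixes tc s0 s1 \<delta> \<epsilon> m z0 z1 :: real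
  assumes tc_pos: "tc > 0" and s01: "s0 < s1" and x01: "x s0 tc = x s1 tc" and J01: "J s0 tc = J s1 tc"
    and \<delta>_pos: "\<delta> > 0" and \<epsilon>_pos: "\<epsilon> > 0" and m_pos: "m > 0"
    and left_good: "t \<in> {tc..<tc + \<epsilon>} \<Longrightarrow> s \<in> {s0 - \<delta><..<s0} \<Longrightarrow> s \<notin> D \<and> deriv (\<lambda>r. x r t) s \<ge> m"
    and right_good: "t \<in> {tc..<tc + \<epsilon>} \<Longrightarrow> s \<in> {s1<..<s1 + \<delta>} \<Longrightarrow> s \<notin> D \<and> deriv (\<lambda>r. x r t) s \<ge> m"
    and g_left: "s \<in> {s0 - \<delta>..s0} \<Longrightarrow> g s \<ge> z0"
    and g_right: "s \<in> {s1..s1 + \<delta>} \<Longrightarrow> g s \<le> z1"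
    and z01: "z1 < z0"
    and z0_sign: "(g s1 * h s1 - F (g s1)) - (g s0 * h s0 - F (g s0)) + z0 * (h s0 - h s1) \<ge> 0"
    and z1_sign: "(g s1 * h s1 - F (g s1)) - (g s0 * h s0 - F (g s0)) + z1 * (h s0 - h s1) \<le> 0"
    and small: "(h s0 - h s1) * \<epsilon> \<le> m * \<delta>"
begin

abbreviation "T \<equiv> {tc..<tc + \<epsilon>}"

lemma h_less: "h s1 < h s0"
  using same_x_less_iff[OF x01 tc_pos] s01 by (simp add: h_def F'_less_iff)

lemma left_expansion:
  assumes "t \<in> T" "s \<in> {s0 - \<delta>..s0}" "s' \<in> {s0 - \<delta>..s0}" "s \<le> s'"
  shows "m * (s' - s) \<le> x s' t - x s t"
  using x_expansion[OF left_good[OF assms(1)] assms(2-4)] .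

lemma right_expansion:
  assumes "t \<in> T" "s \<in> {s1..s1 + \<delta>}" "s' \<in> {s1..s1 + \<delta>}" "s \<le> s'"
  shows "m * (s' - s) \<le> x s' t - x s t"
  using x_expansion[OF right_good[OF assms(1)] assms(2-4)] .

lemma left_strict_mono: "t \<in> T \<Longrightarrow> strict_mono_on {s0 - \<delta>..s0} (\<lambda>s. x s t)"
  using left_expansion m_pos by (intro strict_mono_onI) (smt (verit) mult_pos_pos)

lemma right_strict_mono: "t \<in> T \<Longrightarrow> strict_mono_on {s1..s1 + \<delta>} (\<lambda>s. x s t)"
  using right_expansion m_pos by (intro strict_mono_onI) (smt (verit) mult_pos_pos)

lemma front_between:
  assumes "t \<in> T"
  shows "x (s0 - \<delta>) t < x s1 t" and "x s1 t \<le> x s0 t" and "x s0 t < x (s1 + \<delta>) t"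
proof -
  have eq: "x s0 t - x s1 t = (h s0 - h s1) * (t - tc)"
    using x_time[of s0 t tc] x_time[of s1 t tc] x01 by (simp add: algebra_simps)
  have "(h s0 - h s1) * (t - tc) < (h s0 - h s1) * \<epsilon>"
    using h_less assms by (intro mult_strict_left_mono) auto
  then have lt: "(h s0 - h s1) * (t - tc) < m * \<delta>"
    using small by linarith
  show "x (s0 - \<delta>) t < x s1 t"
    using left_expansion[OF assms, of "s0 - \<delta>" s0] \<delta>_pos eq lt by simp
  show "x s1 t \<le> x s0 t"
  proof -
    have "0 \<le> (h s0 - h s1) * (t - tc)"
      using h_less assms by (intro mult_nonneg_nonneg) auto
    then show ?thesis
      using eq by linarith
  qed
  show "x s0 t < x (s1 + \<delta>) t"
    using right_expansion[OF assms, of s1 "s1 + \<delta>"] \<delta>_pos eq lt by simp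
qed

lemma J_difference:
  "J s1 t - J s0 t = (t - tc) * ((g s1 * h s1 - F (g s1)) - (g s0 * h s0 - F (g s0)))"
  using J_time[of s0 t tc] J_time[of s1 t tc] J01 by (simp add: algebra_simps)

text \<open>The intermediate value theorem, applied to the area as a function of the position of the
  vertical line.\<close>

lemma front_exists:
  assumes t: "t \<in> T"
  shows "\<exists>a b. a \<in> {s0 - \<delta><..s0} \<and> b \<in> {s1..<s1 + \<delta>} \<and> x a t = x b t \<and> J a t = J b t \<and>
    x s1 t \<le> x a t \<and> x a t \<le> x s0 t"
proof -
  let ?L = "{s0 - \<delta>..s0}" and ?R = "{s1..s1 + \<delta>}" and ?X = "\<lambda>s. x s t"
  let ?Y = "{x s1 t..x s0 t}"
  let ?\<Delta> = "x s0 t - x s1 t"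
  have \<Delta>: "?\<Delta> = (h s0 - h s1) * (t - tc)"
    using x_time[of s0 t tc] x_time[of s1 t tc] x01 by (simp add: algebra_simps)
  note bet = front_between[OF t]
  have injL: "inj_on ?X ?L" and injR: "inj_on ?X ?R"
    using left_strict_mono[OF t] right_strict_mono[OF t] strict_mono_on_imp_inj_on by blast+
  define \<alpha> \<beta> where "\<alpha> = the_inv_into ?L ?X" and "\<beta> = the_inv_into ?R ?X"
  have YL: "?Y \<subseteq> ?X ` ?L"
  proof
    fix y assume "y \<in> ?Y"
    then show "y \<in> ?X ` ?L"
      using IVT'[OF _ _ _ x_cont, of "s0 - \<delta>" t y s0] bet \<delta>_pos by auto
  qed
  have YR: "?Y \<subseteq> ?X ` ?R"
  proof
    fix y assume "y \<in> ?Y"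
    then show "y \<in> ?X ` ?R"
      using IVT'[OF _ _ _ x_cont, of s1 t y "s1 + \<delta>"] bet \<delta>_pos by auto
  qed
  have \<alpha>: "\<alpha> y \<in> ?L" "x (\<alpha> y) t = y" if "y \<in> ?Y" for y
    using the_inv_into_into[OF injL, of y ?L] f_the_inv_into_f[OF injL, of y] YL that
    by (auto simp: \<alpha>_def)
  have \<beta>: "\<beta> y \<in> ?R" "x (\<beta> y) t = y" if "y \<in> ?Y" for y
    using the_inv_into_into[OF injR, of y ?R] f_the_inv_into_f[OF injR, of y] YR that
    by (auto simp: \<beta>_def)
  have cont_\<alpha>: "continuous_on ?Y \<alpha>" and cont_\<beta>: "continuous_on ?Y \<beta>"
    using continuous_on_inv_into[OF x_cont compact_Icc injL] continuous_on_inv_into[OF x_cont compact_Icc injR]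
      YL YR continuous_on_subset unfolding \<alpha>_def \<beta>_def by blast+
  define E where "E y = J (\<beta> y) t - J (\<alpha> y) t" for y
  have "continuous_on ?Y E"
    unfolding E_def
    by (intro continuous_intros continuous_on_compose2[OF J_cont cont_\<alpha>]
        continuous_on_compose2[OF J_cont cont_\<beta>]) auto
  have top: "x s0 t \<in> ?Y" and bot: "x s1 t \<in> ?Y"
    using bet(2) by auto
  have \<alpha>_top: "\<alpha> (x s0 t) = s0"
    using \<delta>_pos by (simp add: \<alpha>_def the_inv_into_f_f[OF injL])
  have \<beta>_bot: "\<beta> (x s1 t) = s1"
    using \<delta>_pos by (simp add: \<beta>_def the_inv_into_f_f[OF injR])
  have monoL: "mono_on {p..q} ?X" if "p \<in> ?L" "q \<in> ?L" for p q
    using that by (intro monotone_on_subset[OF strict_mono_on_imp_mono_on[OF left_strict_mono[OF t]]]) auto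
  have monoR: "mono_on {p..q} ?X" if "p \<in> ?R" "q \<in> ?R" for p q
    using that by (intro monotone_on_subset[OF strict_mono_on_imp_mono_on[OF right_strict_mono[OF t]]]) auto
  have "E (x s0 t) \<le> 0"
  proof -
    let ?b = "\<beta> (x s0 t)"
    obtain \<xi> where \<xi>: "\<xi> \<in> {s1..?b}" "J ?b t - J s1 t = g \<xi> * (x ?b t - x s1 t)"
      using J_mean_value[OF _ monoR, of s1 ?b] \<beta>[OF top] \<delta>_pos by auto
    have "g \<xi> \<le> z1"
      using \<xi>(1) \<beta>(1)[OF top] by (intro g_right) auto
    then have "J ?b t - J s1 t \<le> z1 * ?\<Delta>"
      using \<xi>(2) \<beta>(2)[OF top] bet(2) by (simp add: mult_right_mono)
    then have "E (x s0 t) \<le> (t - tc) * ((g s1 * h s1 - F (g s1)) - (g s0 * h s0 - F (g s0)) + z1 * (h s0 - h s1))"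
      using J_difference[of t] by (simp add: E_def \<alpha>_top \<Delta> algebra_simps)
    also have "\<dots> \<le> 0"
      using t z1_sign by (intro mult_nonneg_nonpos) auto
    finally show ?thesis .
  qed
  moreover have "E (x s1 t) \<ge> 0"
  proof -
    let ?a = "\<alpha> (x s1 t)"
    obtain \<xi> where \<xi>: "\<xi> \<in> {?a..s0}" "J s0 t - J ?a t = g \<xi> * (x s0 t - x ?a t)"
      using J_mean_value[OF _ monoL, of ?a s0] \<alpha>[OF bot] \<delta>_pos by auto
    have "g \<xi> \<ge> z0"
      using \<xi>(1) \<alpha>(1)[OF bot] by (intro g_left) auto
    then have "J s0 t - J ?a t \<ge> z0 * ?\<Delta>"
      using \<xi>(2) \<alpha>(2)[OF bot] bet(2) by (simp add: mult_right_mono)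
    then have "E (x s1 t) \<ge> (t - tc) * ((g s1 * h s1 - F (g s1)) - (g s0 * h s0 - F (g s0)) + z0 * (h s0 - h s1))"
      using J_difference[of t] by (simp add: E_def \<beta>_bot \<Delta> algebra_simps)
    moreover have "(t - tc) * ((g s1 * h s1 - F (g s1)) - (g s0 * h s0 - F (g s0)) + z0 * (h s0 - h s1)) \<ge> 0"
      using t z0_sign by (intro mult_nonneg_nonneg) auto
    ultimately show ?thesis by linarith
  qed
  ultimately obtain y where y: "x s1 t \<le> y" "y \<le> x s0 t" "E y = 0"
    using IVT2'[OF _ _ bet(2) \<open>continuous_on ?Y E\<close>] by blast
  then have "y \<in> ?Y" by simp
  have "\<alpha> y \<noteq> s0 - \<delta>" "\<beta> y \<noteq> s1 + \<delta>"
    using \<alpha>(2)[OF \<open>y \<in> ?Y\<close>] \<beta>(2)[OF \<open>y \<in> ?Y\<close>] bet y by auto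
  then show ?thesis
    using \<alpha>[OF \<open>y \<in> ?Y\<close>] \<beta>[OF \<open>y \<in> ?Y\<close>] y
    by (intro exI[of _ "\<alpha> y"] exI[of _ "\<beta> y"]) (auto simp: E_def)
qed

text \<open>An exact form of the Rankine-Hugoniot condition for two positions of the front.\<close>

lemma front_increment:
  assumes t: "t \<in> T" "t' \<in> T"
    and a: "a \<in> {s0 - \<delta>..s0}" "a' \<in> {s0 - \<delta>..s0}" and b: "b \<in> {s1..s1 + \<delta>}" "b' \<in> {s1..s1 + \<delta>}"
    and front: "x a t = x b t" "J a t = J b t" "x a' t' = x b' t'" "J a' t' = J b' t'"
  shows "\<exists>\<xi>\<in>closed_segment a a'. \<exists>\<zeta>\<in>closed_segment b b'.
    (x a' t' - x a t) * (g \<xi> - g \<zeta>) =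
    (t' - t) * (F (g a) - F (g b) + (g \<xi> - g a) * h a - (g \<zeta> - g b) * h b)"
proof -
  have "closed_segment a a' \<subseteq> {s0 - \<delta>..s0}" "closed_segment b b' \<subseteq> {s1..s1 + \<delta>}"
    using a b by (intro closed_segment_subset; simp)+
  then have mono: "mono_on (closed_segment a a') (\<lambda>s. x s t')" "mono_on (closed_segment b b') (\<lambda>s. x s t')"
    using strict_mono_on_imp_mono_on left_strict_mono[OF t(2)] right_strict_mono[OF t(2)]
      monotone_on_subset by metis+
  obtain \<xi> where \<xi>: "\<xi> \<in> closed_segment a a'" "J a' t' - J a t' = g \<xi> * (x a' t' - x a t')"
    using J_mean_value_segment[OF mono(1)] by blast
  obtain \<zeta> where \<zeta>: "\<zeta> \<in> closed_segment b b'" "J b' t' - J b t' = g \<zeta> * (x b' t' - x b t')"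
    using J_mean_value_segment[OF mono(2)] by blast
  have "(x a' t' - x a t) * (g \<xi> - g \<zeta>) =
    (t' - t) * (F (g a) - F (g b) + (g \<xi> - g a) * h a - (g \<zeta> - g b) * h b)"
    using \<xi>(2) \<zeta>(2) front unfolding J_time[of a t' t] J_time[of b t' t] x_time[of a t' t] x_time[of b t' t]
    by (simp add: algebra_simps)
  then show ?thesis
    using \<xi>(1) \<zeta>(1) by blast
qed

lemma propagates: "propagates_at_RH_speed F x g tc s0 s1"
proof -
  have "\<forall>t\<in>T. \<exists>p. fst p \<in> {s0 - \<delta><..s0} \<and> snd p \<in> {s1..<s1 + \<delta>} \<and> x (fst p) t = x (snd p) t \<and>
    J (fst p) t = J (snd p) t \<and> x s1 t \<le> x (fst p) t \<and> x (fst p) t \<le> x s0 t"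
    using front_exists by (metis fst_conv snd_conv)
  then obtain p where p: "\<And>t. t \<in> T \<Longrightarrow> fst (p t) \<in> {s0 - \<delta><..s0} \<and> snd (p t) \<in> {s1..<s1 + \<delta>} \<and>
    x (fst (p t)) t = x (snd (p t)) t \<and> J (fst (p t)) t = J (snd (p t)) t \<and>
    x s1 t \<le> x (fst (p t)) t \<and> x (fst (p t)) t \<le> x s0 t"
    by metis
  define \<sigma>0 \<sigma>1 where "\<sigma>0 t = fst (p t)" and "\<sigma>1 t = snd (p t)" for t
  have L: "\<sigma>0 t \<in> {s0 - \<delta>..s0}" and R: "\<sigma>1 t \<in> {s1..s1 + \<delta>}"
    and L': "s0 - \<delta> < \<sigma>0 t" "\<sigma>0 t \<le> s0" and R': "s1 \<le> \<sigma>1 t" "\<sigma>1 t < s1 + \<delta>"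
    and front: "x (\<sigma>0 t) t = x (\<sigma>1 t) t" "J (\<sigma>0 t) t = J (\<sigma>1 t) t"
    and bet: "x s1 t \<le> x (\<sigma>0 t) t" "x (\<sigma>0 t) t \<le> x s0 t" if "t \<in> T" for t
    using p[OF that] by (auto simp: \<sigma>0_def \<sigma>1_def)
  have tc: "tc \<in> T"
    using \<epsilon>_pos by simp
  have \<sigma>0_tc: "\<sigma>0 tc = s0"
    using left_expansion[OF tc L[OF tc], of s0] L'[OF tc] bet[OF tc] x01 m_pos \<delta>_pos
    by (auto simp: mult_le_0_iff)
  have \<sigma>1_tc: "\<sigma>1 tc = s1"
    using right_expansion[OF tc _ R[OF tc], of s1] R'[OF tc] bet[OF tc] front(1)[OF tc] x01 m_pos \<delta>_pos
    by (auto simp: mult_le_0_iff)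
  have regular: "\<exists>C0 C1. \<forall>t'\<in>T. \<bar>\<sigma>0 t' - \<sigma>0 t\<bar> \<le> C0 * \<bar>t' - t\<bar> \<and> \<bar>\<sigma>1 t' - \<sigma>1 t\<bar> \<le> C1 * \<bar>t' - t\<bar>"
    and RH: "((\<lambda>r. x (\<sigma>0 r) r) has_real_derivative
      (F (g (\<sigma>0 t)) - F (g (\<sigma>1 t))) / (g (\<sigma>0 t) - g (\<sigma>1 t))) (at t within T)" if t: "t \<in> T" for t
  proof -
    let ?a = "\<sigma>0 t" and ?b = "\<sigma>1 t"
    let ?y = "\<lambda>t'. x (\<sigma>0 t') t'"
    let ?N = "\<lambda>u v. F (g ?a) - F (g ?b) + (g u - g ?a) * h ?a - (g v - g ?b) * h ?b"
    have "\<forall>t'\<in>T. \<exists>q. fst q \<in> closed_segment ?a (\<sigma>0 t') \<and> snd q \<in> closed_segment ?b (\<sigma>1 t') \<and>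
        (?y t' - ?y t) * (g (fst q) - g (snd q)) = (t' - t) * ?N (fst q) (snd q)"
    proof
      fix t' assume t': "t' \<in> T"
      show "\<exists>q. fst q \<in> closed_segment ?a (\<sigma>0 t') \<and> snd q \<in> closed_segment ?b (\<sigma>1 t') \<and>
        (?y t' - ?y t) * (g (fst q) - g (snd q)) = (t' - t) * ?N (fst q) (snd q)"
        using front_increment[OF t t' L[OF t] L[OF t'] R[OF t] R[OF t'] front[OF t] front[OF t']]
        by (metis fst_conv snd_conv)
    qed
    then obtain q where q: "\<And>t'. t' \<in> T \<Longrightarrow> fst (q t') \<in> closed_segment ?a (\<sigma>0 t') \<and>
        snd (q t') \<in> closed_segment ?b (\<sigma>1 t') \<and>
        (?y t' - ?y t) * (g (fst (q t')) - g (snd (q t'))) = (t' - t) * ?N (fst (q t')) (snd (q t'))"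
      by metis
    define \<xi> \<zeta> where "\<xi> t' = fst (q t')" and "\<zeta> t' = snd (q t')" for t'
    have seg: "\<xi> t' \<in> closed_segment ?a (\<sigma>0 t')" "\<zeta> t' \<in> closed_segment ?b (\<sigma>1 t')"
      and incr: "(?y t' - ?y t) * (g (\<xi> t') - g (\<zeta> t')) = (t' - t) * ?N (\<xi> t') (\<zeta> t')" if "t' \<in> T" for t'
      using q[OF that] by (auto simp: \<xi>_def \<zeta>_def)
    have gap: "g (\<xi> t') - g (\<zeta> t') \<ge> z0 - z1" if t': "t' \<in> T" for t'
    proof -
      have "\<xi> t' \<in> {s0 - \<delta>..s0}" "\<zeta> t' \<in> {s1..s1 + \<delta>}"
        using seg[OF t'] L[OF t] L[OF t'] R[OF t] R[OF t'] by (auto simp: closed_segment_eq_real_ivl split: if_splits)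
      then show ?thesis
        using g_left[of "\<xi> t'"] g_right[of "\<zeta> t'"] by linarith
    qed
    define K where "K = (\<bar>F (g ?a) - F (g ?b)\<bar> + 2 * M * \<bar>h ?a\<bar> + 2 * M * \<bar>h ?b\<bar>) / (z0 - z1)"
    have y_lip: "\<bar>?y t' - ?y t\<bar> \<le> K * \<bar>t' - t\<bar>" if t': "t' \<in> T" for t'
    proof -
      have "\<bar>?y t' - ?y t\<bar> * (z0 - z1) \<le> \<bar>?y t' - ?y t\<bar> * \<bar>g (\<xi> t') - g (\<zeta> t')\<bar>"
        using gap[OF t'] by (intro mult_left_mono) auto
      also have "\<dots> = \<bar>t' - t\<bar> * \<bar>?N (\<xi> t') (\<zeta> t')\<bar>"
        using incr[OF t'] by (simp flip: abs_mult)
      also have "\<dots> \<le> \<bar>t' - t\<bar> * (K * (z0 - z1))"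
      proof (rule mult_left_mono)
        have diff: "\<bar>g u - g v\<bar> \<le> 2 * M" for u v
          using g_bound[of u] g_bound[of v] by linarith
        have "\<bar>(g (\<xi> t') - g ?a) * h ?a\<bar> \<le> 2 * M * \<bar>h ?a\<bar>" "\<bar>(g (\<zeta> t') - g ?b) * h ?b\<bar> \<le> 2 * M * \<bar>h ?b\<bar>"
          unfolding abs_mult by (intro mult_right_mono diff; simp)+
        then have "\<bar>?N (\<xi> t') (\<zeta> t')\<bar> \<le> \<bar>F (g ?a) - F (g ?b)\<bar> + 2 * M * \<bar>h ?a\<bar> + 2 * M * \<bar>h ?b\<bar>"
          by linarith
        then show "\<bar>?N (\<xi> t') (\<zeta> t')\<bar> \<le> K * (z0 - z1)"
          using z01 by (simp add: K_def)
      qed simp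
      finally have "\<bar>?y t' - ?y t\<bar> * (z0 - z1) \<le> (K * \<bar>t' - t\<bar>) * (z0 - z1)"
        by (simp add: algebra_simps)
      then show ?thesis
        using z01 by (simp add: mult_le_cancel_right)
    qed
    have lip0: "\<bar>\<sigma>0 t' - ?a\<bar> \<le> (K + \<bar>h ?a\<bar>) / m * \<bar>t' - t\<bar>" if t': "t' \<in> T" for t'
    proof -
      have "m * \<bar>\<sigma>0 t' - ?a\<bar> \<le> \<bar>?y t' - x ?a t'\<bar>"
        using left_expansion[OF t' L[OF t] L[OF t']] left_expansion[OF t' L[OF t'] L[OF t]]
        by (cases "?a \<le> \<sigma>0 t'") auto
      also have "\<dots> = \<bar>(?y t' - ?y t) - h ?a * (t' - t)\<bar>"
        using x_time[of ?a t' t] by simp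
      also have "\<dots> \<le> K * \<bar>t' - t\<bar> + \<bar>h ?a\<bar> * \<bar>t' - t\<bar>"
        using y_lip[OF t'] abs_mult[of "h ?a" "t' - t"] by linarith
      finally show ?thesis
        using m_pos by (simp add: field_simps)
    qed
    have lip1: "\<bar>\<sigma>1 t' - ?b\<bar> \<le> (K + \<bar>h ?b\<bar>) / m * \<bar>t' - t\<bar>" if t': "t' \<in> T" for t'
    proof -
      have "m * \<bar>\<sigma>1 t' - ?b\<bar> \<le> \<bar>x (\<sigma>1 t') t' - x ?b t'\<bar>"
        using right_expansion[OF t' R[OF t] R[OF t']] right_expansion[OF t' R[OF t'] R[OF t]]
        by (cases "?b \<le> \<sigma>1 t'") auto
      also have "\<dots> = \<bar>(?y t' - ?y t) - h ?b * (t' - t)\<bar>"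
        using x_time[of ?b t' t] front(1)[OF t] front(1)[OF t'] by simp
      also have "\<dots> \<le> K * \<bar>t' - t\<bar> + \<bar>h ?b\<bar> * \<bar>t' - t\<bar>"
        using y_lip[OF t'] abs_mult[of "h ?b" "t' - t"] by linarith
      finally show ?thesis
        using m_pos by (simp add: field_simps)
    qed
    show "\<exists>C0 C1. \<forall>t'\<in>T. \<bar>\<sigma>0 t' - \<sigma>0 t\<bar> \<le> C0 * \<bar>t' - t\<bar> \<and> \<bar>\<sigma>1 t' - \<sigma>1 t\<bar> \<le> C1 * \<bar>t' - t\<bar>"
      using lip0 lip1 by blast
    have "(\<xi> \<longlongrightarrow> ?a) (at t within T)"
    proof (rule tendsto_of_lipschitz)
      fix t' assume t': "t' \<in> T"
      have "\<bar>\<xi> t' - ?a\<bar> \<le> \<bar>\<sigma>0 t' - ?a\<bar>"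
        using seg(1)[OF t'] by (auto simp: closed_segment_eq_real_ivl split: if_splits)
      then show "\<bar>\<xi> t' - ?a\<bar> \<le> (K + \<bar>h ?a\<bar>) / m * \<bar>t' - t\<bar>"
        using lip0[OF t'] by linarith
    qed
    then have g\<xi>: "((\<lambda>t'. g (\<xi> t')) \<longlongrightarrow> g ?a) (at t within T)"
      by (rule tendsto_g)
    have "(\<zeta> \<longlongrightarrow> ?b) (at t within T)"
    proof (rule tendsto_of_lipschitz)
      fix t' assume t': "t' \<in> T"
      have "\<bar>\<zeta> t' - ?b\<bar> \<le> \<bar>\<sigma>1 t' - ?b\<bar>"
        using seg(2)[OF t'] by (auto simp: closed_segment_eq_real_ivl split: if_splits)
      then show "\<bar>\<zeta> t' - ?b\<bar> \<le> (K + \<bar>h ?b\<bar>) / m * \<bar>t' - t\<bar>"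
        using lip1[OF t'] by linarith
    qed
    then have g\<zeta>: "((\<lambda>t'. g (\<zeta> t')) \<longlongrightarrow> g ?b) (at t within T)"
      by (rule tendsto_g)
    have "g ?a - g ?b \<noteq> 0"
      using g_left[OF L[OF t]] g_right[OF R[OF t]] z01 by linarith
    then have "((\<lambda>t'. ?N (\<xi> t') (\<zeta> t') / (g (\<xi> t') - g (\<zeta> t'))) \<longlongrightarrow>
        (F (g ?a) - F (g ?b) + (g ?a - g ?a) * h ?a - (g ?b - g ?b) * h ?b) / (g ?a - g ?b)) (at t within T)"
      by (intro tendsto_intros g\<xi> g\<zeta>)
    moreover have "eventually (\<lambda>t'. ?N (\<xi> t') (\<zeta> t') / (g (\<xi> t') - g (\<zeta> t')) = (?y t' - ?y t) / (t' - t)) (at t within T)"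
      unfolding eventually_at_filter
    proof (intro always_eventually allI impI)
      fix t' assume "t' \<noteq> t" "t' \<in> T"
      then show "?N (\<xi> t') (\<zeta> t') / (g (\<xi> t') - g (\<zeta> t')) = (?y t' - ?y t) / (t' - t)"
        using incr[of t'] gap[of t'] z01 by (subst frac_eq_eq) (auto simp: mult.commute)
    qed
    ultimately show "(?y has_real_derivative (F (g ?a) - F (g ?b)) / (g ?a - g ?b)) (at t within T)"
      unfolding has_field_derivative_iff using Lim_transform_eventually by fastforce
  qed
  have cont: "continuous_on T \<sigma>0" "continuous_on T \<sigma>1"
    unfolding continuous_on_def using regular tendsto_of_lipschitz[of T] by (metis (lifting))+
  have pairs: "(\<sigma>0 t, \<sigma>1 t) \<in> equal_area_pairs x g t" if t: "t \<in> T" for t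
  proof -
    have "t > 0"
      using t tc_pos by simp
    obtain l0 where l0: "(deriv (\<lambda>r. x r t) \<longlongrightarrow> l0) (at_left (\<sigma>0 t))"
      using deriv_x_one_sided_limits unfolding has_one_sided_limits_def by blast
    have "eventually (\<lambda>s. s \<in> {s0 - \<delta><..<\<sigma>0 t}) (at_left (\<sigma>0 t))"
      using L'[OF t] by (intro eventually_at_leftI[of "s0 - \<delta>"]) auto
    then have "eventually (\<lambda>s. deriv (\<lambda>r. x r t) s \<ge> m) (at_left (\<sigma>0 t))"
      by eventually_elim (use left_good[OF t] L'[OF t] in auto)
    then have "l0 \<ge> m"
      using tendsto_lowerbound[OF l0] by simp
    moreover obtain l1 where l1: "(deriv (\<lambda>r. x r t) \<longlongrightarrow> l1) (at_right (\<sigma>1 t))"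
      using deriv_x_one_sided_limits unfolding has_one_sided_limits_def by blast
    have "eventually (\<lambda>s. s \<in> {\<sigma>1 t<..<s1 + \<delta>}) (at_right (\<sigma>1 t))"
      using R'[OF t] by (intro eventually_at_rightI[of _ "s1 + \<delta>"]) auto
    then have "eventually (\<lambda>s. deriv (\<lambda>r. x r t) s \<ge> m) (at_right (\<sigma>1 t))"
      by eventually_elim (use right_good[OF t] R'[OF t] in auto)
    then have "l1 \<ge> m"
      using tendsto_lowerbound[OF l1] by simp
    moreover have "\<sigma>0 t < \<sigma>1 t"
      using L'[OF t] R'[OF t] s01 by linarith
    ultimately show ?thesis
      unfolding equal_area_pairs_iff[OF \<open>t > 0\<close>] using front[OF t] l0 l1 m_pos
      by (metis order_less_le_trans)
  qed
  have mono: "strict_mono_on {s0 - \<delta>..\<sigma>0 t} (\<lambda>s. x s t)" "strict_mono_on {\<sigma>1 t..s1 + \<delta>} (\<lambda>s. x s t)"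
    if t: "t \<in> T" for t
    using L'[OF t] R'[OF t]
    by (intro monotone_on_subset[OF left_strict_mono[OF t]] monotone_on_subset[OF right_strict_mono[OF t]]; simp)+
  have ord: "s0 - \<delta> < \<sigma>0 t" "\<sigma>0 t < \<sigma>1 t" "\<sigma>1 t < s1 + \<delta>" if t: "t \<in> T" for t
    using L'[OF t] R'[OF t] s01 by linarith+
  show ?thesis
    unfolding propagates_at_RH_speed_def
    by (intro exI[of _ \<epsilon>] exI[of _ \<delta>] exI[of _ \<sigma>0] exI[of _ \<sigma>1] conjI ballI
        \<epsilon>_pos \<delta>_pos \<sigma>0_tc \<sigma>1_tc cont pairs mono ord RH)
qed

end

context characteristics
begin

lemma shock_propagates:
  assumes tc: "tc > 0" and s01: "s0 < s1" and x01: "x s0 tc = x s1 tc" and J01: "J s0 tc = J s1 tc"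
    and left: "\<exists>l>0. (deriv (\<lambda>r. x r tc) \<longlongrightarrow> l) (at_left s0)"
    and right: "\<exists>l>0. (deriv (\<lambda>r. x r tc) \<longlongrightarrow> l) (at_right s1)"
  shows "propagates_at_RH_speed F x g tc s0 s1"
proof -
  obtain l0 where l0: "l0 > 0" "(deriv (\<lambda>r. x r tc) \<longlongrightarrow> l0) (at_left s0)"
    using left by blast
  obtain m0 \<epsilon>0 where 0: "m0 > 0" "\<epsilon>0 > 0"
    "eventually (\<lambda>s. s \<notin> D \<and> (\<forall>t\<in>{tc..<tc + \<epsilon>0}. deriv (\<lambda>r. x r t) s \<ge> m0)) (at_left s0)"
    using deriv_x_locally_bounded_below[OF tc at_le[OF subset_UNIV] l0] by blast
  obtain l1 where l1: "l1 > 0" "(deriv (\<lambda>r. x r tc) \<longlongrightarrow> l1) (at_right s1)"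
    using right by blast
  obtain m1 \<epsilon>1 where 1: "m1 > 0" "\<epsilon>1 > 0"
    "eventually (\<lambda>s. s \<notin> D \<and> (\<forall>t\<in>{tc..<tc + \<epsilon>1}. deriv (\<lambda>r. x r t) s \<ge> m1)) (at_right s1)"
    using deriv_x_locally_bounded_below[OF tc at_le[OF subset_UNIV] l1] by blast
  have g_less: "g s1 < g s0"
    using same_x_less_iff[OF x01 tc] s01 by simp
  have h_less: "h s1 < h s0"
    using g_less by (simp add: h_def F'_less_iff)
  define C where "C = (g s1 * h s1 - F (g s1)) - (g s0 * h s0 - F (g s0))"
  define z where "z = - C / (h s0 - h s1)"
  have Cz: "C + z * (h s0 - h s1) = 0"
    using h_less by (simp add: z_def)
  have "C + g s1 * (h s0 - h s1) < 0"
    using F_above_tangent[of "g s0" "g s1"] g_less by (simp add: C_def h_def algebra_simps)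
  then have z1: "g s1 < z"
    using Cz h_less by (smt (verit) mult_right_mono)
  have "C + g s0 * (h s0 - h s1) > 0"
    using F_above_tangent[of "g s1" "g s0"] g_less by (simp add: C_def h_def algebra_simps)
  then have z0: "z < g s0"
    using Cz h_less by (smt (verit) mult_right_mono)
  define \<zeta>0 \<zeta>1 where "\<zeta>0 = (z + g s0) / 2" and "\<zeta>1 = (z + g s1) / 2"
  have \<zeta>: "\<zeta>1 < z" "z < \<zeta>0" "\<zeta>0 < g s0" "g s1 < \<zeta>1"
    using z0 z1 by (simp_all add: \<zeta>0_def \<zeta>1_def)
  have "((\<lambda>s. g s) \<longlongrightarrow> g s0) (at_left s0)" "((\<lambda>s. g s) \<longlongrightarrow> g s1) (at_right s1)"
    by (auto intro!: tendsto_g tendsto_ident_at)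
  then have "eventually (\<lambda>s. \<zeta>0 < g s) (at_left s0)" "eventually (\<lambda>s. g s < \<zeta>1) (at_right s1)"
    using order_tendstoD \<zeta>(3,4) by blast+
  with 0(3) 1(3) have
    "eventually (\<lambda>s. (s \<notin> D \<and> (\<forall>t\<in>{tc..<tc + \<epsilon>0}. deriv (\<lambda>r. x r t) s \<ge> m0)) \<and> \<zeta>0 < g s) (at_left s0)"
    "eventually (\<lambda>s. (s \<notin> D \<and> (\<forall>t\<in>{tc..<tc + \<epsilon>1}. deriv (\<lambda>r. x r t) s \<ge> m1)) \<and> g s < \<zeta>1) (at_right s1)"
    by (simp_all add: eventually_conj_iff)
  then obtain p q where pq: "p < s0" "s1 < q"
    and p: "\<And>s. p < s \<Longrightarrow> s < s0 \<Longrightarrow> (s \<notin> D \<and> (\<forall>t\<in>{tc..<tc + \<epsilon>0}. deriv (\<lambda>r. x r t) s \<ge> m0)) \<and> \<zeta>0 < g s"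
    and q: "\<And>s. s1 < s \<Longrightarrow> s < q \<Longrightarrow> (s \<notin> D \<and> (\<forall>t\<in>{tc..<tc + \<epsilon>1}. deriv (\<lambda>r. x r t) s \<ge> m1)) \<and> g s < \<zeta>1"
    unfolding eventually_at_left_field eventually_at_right_field by blast
  define \<delta> where "\<delta> = min (s0 - p) (q - s1) / 2"
  have \<delta>: "\<delta> > 0" "p < s0 - \<delta>" "s1 + \<delta> < q"
    using pq by (auto simp: \<delta>_def min_def field_simps)
  define m where "m = min m0 m1"
  have m: "m > 0" "m \<le> m0" "m \<le> m1"
    using 0(1) 1(1) by (auto simp: m_def)
  define \<epsilon> where "\<epsilon> = min (min \<epsilon>0 \<epsilon>1) (m * \<delta> / (h s0 - h s1))"
  have \<epsilon>: "\<epsilon> > 0" "\<epsilon> \<le> \<epsilon>0" "\<epsilon> \<le> \<epsilon>1" "\<epsilon> \<le> m * \<delta> / (h s0 - h s1)"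
    using 0(2) 1(2) m(1) \<delta>(1) h_less by (auto simp: \<epsilon>_def)
  interpret shock_fan F g G D M tc s0 s1 \<delta> \<epsilon> m \<zeta>0 \<zeta>1
  proof
    show "s \<notin> D \<and> m \<le> deriv (\<lambda>r. x r t) s" if "t \<in> {tc..<tc + \<epsilon>}" "s \<in> {s0 - \<delta><..<s0}" for t s
      using p[of s] that \<delta> \<epsilon> m by force
    show "s \<notin> D \<and> m \<le> deriv (\<lambda>r. x r t) s" if "t \<in> {tc..<tc + \<epsilon>}" "s \<in> {s1<..<s1 + \<delta>}" for t s
      using q[of s] that \<delta> \<epsilon> m by force
    show "\<zeta>0 \<le> g s" if "s \<in> {s0 - \<delta>..s0}" for s
      using p[of s] that \<delta> \<zeta>(3) by (cases "s = s0") auto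
    show "g s \<le> \<zeta>1" if "s \<in> {s1..s1 + \<delta>}" for s
      using q[of s] that \<delta> \<zeta>(4) by (cases "s = s1") auto
    show "0 \<le> g s1 * h s1 - F (g s1) - (g s0 * h s0 - F (g s0)) + \<zeta>0 * (h s0 - h s1)"
    proof -
      have "z * (h s0 - h s1) \<le> \<zeta>0 * (h s0 - h s1)"
        using \<zeta>(2) h_less by (intro mult_right_mono) auto
      then show ?thesis
        unfolding C_def[symmetric] using Cz by linarith
    qed
    show "g s1 * h s1 - F (g s1) - (g s0 * h s0 - F (g s0)) + \<zeta>1 * (h s0 - h s1) \<le> 0"
    proof -
      have "\<zeta>1 * (h s0 - h s1) \<le> z * (h s0 - h s1)"
        using \<zeta>(1) h_less by (intro mult_right_mono) auto
      then show ?thesis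
        unfolding C_def[symmetric] using Cz by linarith
    qed
    show "(h s0 - h s1) * \<epsilon> \<le> m * \<delta>"
      using \<epsilon>(4) h_less by (simp add: pos_le_divide_eq mult.commute)
  qed (use tc s01 x01 J01 \<delta>(1) \<epsilon>(1) m(1) \<zeta> in auto)
  show ?thesis
    by (rule propagates)
qed

section \<open>The collision\<close>

lemma one_shock_equal_area_curve:
  assumes tc: "tc > 0" and s01: "s0 < s1" and X: "x s0 tc = X" "x s1 tc = X" and J01: "J s0 tc = J s1 tc"
    and mono: "strict_mono_on {..s0} (\<lambda>s. x s tc)" "strict_mono_on {s1..} (\<lambda>s. x s tc)"
    and v: "piecewise_C1 v" and vg: "\<And>s. s < s0 \<or> s1 < s \<Longrightarrow> v (x s tc) = g s"
    and l: "\<exists>l>0. (deriv (\<lambda>r. x r tc) \<longlongrightarrow> l) (at_left s0)"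
      "\<exists>l>0. (deriv (\<lambda>r. x r tc) \<longlongrightarrow> l) (at_right s1)"
  shows "equal_area_curve x g tc {(s0, s1)} (v(X := g s0))"
proof -
  let ?v = "v(X := g s0)"
  have g_less: "g s1 < g s0"
    using same_x_less_iff[of s0 tc s1] X tc s01 by simp
  have below: "x s tc < X" if "s < s0" for s
    using strict_mono_onD[OF mono(1), of s s0] that X by simp
  have above: "X < x s tc" if "s1 < s" for s
    using strict_mono_onD[OF mono(2), of s1 s] that X by simp
  obtain H where H: "\<And>s t. t \<ge> 0 \<Longrightarrow> \<bar>x s t - s\<bar> \<le> H * t"
    using x_displacement_bounded by blast
  have onto_left: "\<exists>s<s0. x s tc = Y" if Y: "Y < X" for Y
  proof -
    let ?r = "min s0 (Y - H * tc)"
    have "x ?r tc \<le> ?r + H * tc"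
      using H[of tc ?r] tc by (simp add: abs_le_iff)
    then have "x ?r tc \<le> Y"
      by linarith
    moreover have "Y \<le> x s0 tc" "?r \<le> s0"
      using Y X by auto
    ultimately obtain s where "s \<le> s0" "x s tc = Y"
      using IVT'[OF _ _ _ x_cont] by blast
    then show ?thesis
      using Y X by (intro exI[of _ s]) (auto simp: order_less_le)
  qed
  have onto_right: "\<exists>s>s1. x s tc = Y" if Y: "X < Y" for Y
  proof -
    let ?r = "max s1 (Y + H * tc)"
    have "?r - H * tc \<le> x ?r tc"
      using H[of tc ?r] tc by (simp add: abs_le_iff)
    then have "Y \<le> x ?r tc"
      by linarith
    moreover have "x s1 tc \<le> Y" "s1 \<le> ?r"
      using Y X by auto
    ultimately obtain s where "s1 \<le> s" "x s tc = Y"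
      using IVT'[OF _ _ _ x_cont] by blast
    then show ?thesis
      using Y X by (intro exI[of _ s]) (auto simp: order_less_le)
  qed
  have mem: "(Y, y) \<in> replaced_curve x g tc {(s0, s1)} \<longleftrightarrow>
      (\<exists>s. (s \<le> s0 \<or> s1 \<le> s) \<and> x s tc = Y \<and> g s = y) \<or> (Y = X \<and> y \<in> {g s1..g s0})" for Y y
    using s01 X(1) by (auto simp: replaced_curve_def open_segment_eq_real_ivl not_less)
  have off: "{y. (Y, y) \<in> replaced_curve x g tc {(s0, s1)}} = {?v Y}" if "Y \<noteq> X" for Y
  proof (cases "Y < X")
    case True
    then obtain s where s: "s < s0" "x s tc = Y"
      using onto_left by blast
    have "v Y = g s"
      using vg s by blast
    moreover have "s' = s" if "s' \<le> s0 \<or> s1 \<le> s'" "x s' tc = Y" for s'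
    proof -
      have "s' \<le> s0"
        using that True above[of s'] X by (cases "s' = s1") auto
      then show ?thesis
        using strict_mono_on_imp_inj_on[OF mono(1)] s that(2) by (auto simp: inj_on_def)
    qed
    ultimately have "(\<exists>s'. (s' \<le> s0 \<or> s1 \<le> s') \<and> x s' tc = Y \<and> g s' = y) \<longleftrightarrow> y = v Y" for y
      using s by (metis less_imp_le)
    then show ?thesis
      unfolding mem using that by simp
  next
    case False
    then have "X < Y" using that by simp
    then obtain s where s: "s1 < s" "x s tc = Y"
      using onto_right by blast
    have "v Y = g s"
      using vg s by blast
    moreover have "s' = s" if "s' \<le> s0 \<or> s1 \<le> s'" "x s' tc = Y" for s'
    proof -
      have "s1 \<le> s'"
        using that \<open>X < Y\<close> below[of s'] X by (cases "s' = s0") auto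
      then show ?thesis
        using strict_mono_on_imp_inj_on[OF mono(2)] s that(2) by (auto simp: inj_on_def)
    qed
    ultimately have "(\<exists>s'. (s' \<le> s0 \<or> s1 \<le> s') \<and> x s' tc = Y \<and> g s' = y) \<longleftrightarrow> y = v Y" for y
      using s by (metis less_imp_le)
    then show ?thesis
      unfolding mem using that by simp
  qed
  have at_X: "{y. (X, y) \<in> replaced_curve x g tc {(s0, s1)}} = {g s1..g s0}"
  proof -
    have "g s \<in> {g s1..g s0}" if "s \<le> s0 \<or> s1 \<le> s" "x s tc = X" for s
    proof -
      have "s = s0 \<or> s = s1"
        using below[of s] above[of s] that by force
      then show ?thesis
        using g_less by auto
    qed
    then show ?thesis
      unfolding mem by blast
  qed
  have v_left: "(?v \<longlongrightarrow> g s0) (at_left X)"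
  proof -
    obtain L where L: "(?v \<longlongrightarrow> L) (at_left X)"
      using piecewise_C1_one_sided_limits(1)[OF piecewise_C1_fun_upd[OF v]]
      unfolding has_one_sided_limits_def by blast
    have "((\<lambda>s. x s tc) \<longlongrightarrow> x s0 tc) (at_left s0)"
      by (rule tendsto_x) (auto intro: tendsto_ident_at)
    moreover have ev: "eventually (\<lambda>s. s < s0) (at_left s0)"
      by (simp add: eventually_at_filter)
    moreover have "x s tc < X \<and> x s tc \<noteq> X" if "s < s0" for s
      using below[OF that] by simp
    ultimately have "filterlim (\<lambda>s. x s tc) (at_left X) (at_left s0)"
      unfolding filterlim_at using X by (auto intro!: eventually_mono[OF ev])
    from filterlim_compose[OF L this] have "((\<lambda>s. ?v (x s tc)) \<longlongrightarrow> L) (at_left s0)" .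
    moreover have "eventually (\<lambda>s. ?v (x s tc) = g s) (at_left s0)"
      using ev by eventually_elim (use below vg in force)
    ultimately have "(g \<longlongrightarrow> L) (at_left s0)"
      using Lim_transform_eventually by fast
    moreover have "(g \<longlongrightarrow> g s0) (at_left s0)"
      using tendsto_g[OF tendsto_ident_at] .
    ultimately show ?thesis
      using L tendsto_unique[of "at_left s0" g L "g s0"] by simp
  qed
  have v_right: "(?v \<longlongrightarrow> g s1) (at_right X)"
  proof -
    obtain L where L: "(?v \<longlongrightarrow> L) (at_right X)"
      using piecewise_C1_one_sided_limits(1)[OF piecewise_C1_fun_upd[OF v]]
      unfolding has_one_sided_limits_def by blast
    have "((\<lambda>s. x s tc) \<longlongrightarrow> x s1 tc) (at_right s1)"
      by (rule tendsto_x) (auto intro: tendsto_ident_at)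
    moreover have ev: "eventually (\<lambda>s. s1 < s) (at_right s1)"
      by (simp add: eventually_at_filter)
    moreover have "X < x s tc \<and> x s tc \<noteq> X" if "s1 < s" for s
      using above[OF that] by simp
    ultimately have "filterlim (\<lambda>s. x s tc) (at_right X) (at_right s1)"
      unfolding filterlim_at using X by (auto intro!: eventually_mono[OF ev])
    from filterlim_compose[OF L this] have "((\<lambda>s. ?v (x s tc)) \<longlongrightarrow> L) (at_right s1)" .
    moreover have "eventually (\<lambda>s. ?v (x s tc) = g s) (at_right s1)"
      using ev by eventually_elim (use above vg in force)
    ultimately have "(g \<longlongrightarrow> L) (at_right s1)"
      using Lim_transform_eventually by fast
    moreover have "(g \<longlongrightarrow> g s1) (at_right s1)"
      using tendsto_g[OF tendsto_ident_at] .
    ultimately show ?thesis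
      using L tendsto_unique[of "at_right s1" g L "g s1"] by simp
  qed
  have "replacement_function x g tc {(s0, s1)} ?v"
    unfolding replacement_function_def Let_def
  proof
    fix Y
    show "{y. (Y, y) \<in> replaced_curve x g tc {(s0, s1)}} = {?v Y} \<or>
      (\<exists>(p0, p1)\<in>{(s0, s1)}. x p0 tc = Y \<and>
         {y. (Y, y) \<in> replaced_curve x g tc {(s0, s1)}} = {g p1..g p0} \<and>
         ?v Y \<in> {y. (Y, y) \<in> replaced_curve x g tc {(s0, s1)}} \<and>
         (?v \<longlongrightarrow> g p0) (at_left Y) \<and> (?v \<longlongrightarrow> g p1) (at_right Y))"
    proof (cases "Y = X")
      case True
      show ?thesis
        unfolding True at_X using X v_left v_right g_less by simp
    next
      case False
      then show ?thesis
        by (intro disjI1 off)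
    qed
  qed
  moreover have "{(s0, s1)} \<subseteq> equal_area_pairs x g tc"
    using equal_area_pairs_iff[OF tc, of s0 s1] s01 X J01 l by simp
  ultimately show ?thesis
    unfolding equal_area_curve_def using piecewise_C1_fun_upd[OF v] by simp
qed

lemma collision:
  assumes tc: "tc > 0" and AB: "A < B" "x A tc = X" "x B tc = X" "J A tc = J B tc"
    and mono: "mono_on {..A} (\<lambda>s. x s tc)" "mono_on {B..} (\<lambda>s. x s tc)"
    and v: "piecewise_C1 v" and cont: "continuous_on (- {X}) v"
    and trace: "trace_on tc v {..<A}" "trace_on tc v {B<..}"
  shows "\<exists>s0 s1. equal_area_curve x g tc {(s0, s1)} (v(X := g s0)) \<and> x s0 tc = X \<and>
    propagates_at_RH_speed F x g tc s0 s1"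
proof -
  have isCont: "isCont v Y" if "Y \<noteq> X" for Y
    using cont that continuous_on_eq_continuous_at[OF open_Compl[OF closed_singleton]] by blast
  have left: "v (x s tc) = g s" if "s \<le> A" "x s tc \<noteq> X" for s
    by (rule trace_eq[OF tc trace(1), of "{..A}" X]) (use AB mono isCont that in auto)
  have right: "v (x s tc) = g s" if "B \<le> s" "x s tc \<noteq> X" for s
    by (rule trace_eq[OF tc trace(2), of "{B..}" X]) (use AB mono isCont that in auto)
  obtain s0 where s0: "s0 \<le> A" "x s0 tc = X" "\<And>s. s \<le> A \<Longrightarrow> x s tc = X \<Longrightarrow> s0 \<le> s"
    using compact_attains_inf[OF level_set_compact[OF tc, of "{..A}" X]] AB(2) by auto
  obtain s1 where s1: "B \<le> s1" "x s1 tc = X" "\<And>s. B \<le> s \<Longrightarrow> x s tc = X \<Longrightarrow> s \<le> s1"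
    using compact_attains_sup[OF level_set_compact[OF tc, of "{B..}" X]] AB(3) by auto
  have s01: "s0 < s1"
    using s0(1) s1(1) AB(1) by simp
  have ne0: "x s tc \<noteq> X" if "s < s0" for s
    using s0(1) s0(3)[of s] that by auto
  have ne1: "x s tc \<noteq> X" if "s1 < s" for s
    using s1(1) s1(3)[of s] that by auto
  have vg: "v (x s tc) = g s" if "s < s0 \<or> s1 < s" for s
    using that left[of s] right[of s] ne0 ne1 s0(1) s1(1) by auto
  have mono0: "strict_mono_on {..s0} (\<lambda>s. x s tc)"
  proof (rule strict_mono_onI)
    fix s s' assume s: "s \<in> {..s0}" "s' \<in> {..s0}" "s < s'"
    have "x s tc \<noteq> x s' tc"
    proof (cases "s' = s0")
      case True
      then show ?thesis
        using ne0[of s] s s0(2) by auto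
    next
      case False
      then show ?thesis
        using vg[of s] vg[of s'] s same_x_same_g[OF _ tc, of s s'] by auto
    qed
    moreover have "x s tc \<le> x s' tc"
      using mono_onD[OF mono(1), of s s'] s s0(1) by simp
    ultimately show "x s tc < x s' tc"
      by simp
  qed
  have mono1: "strict_mono_on {s1..} (\<lambda>s. x s tc)"
  proof (rule strict_mono_onI)
    fix s s' assume s: "s \<in> {s1..}" "s' \<in> {s1..}" "s < s'"
    have "x s tc \<noteq> x s' tc"
    proof (cases "s = s1")
      case True
      then show ?thesis
        using ne1[of s'] s s1(2) by auto
    next
      case False
      then show ?thesis
        using vg[of s] vg[of s'] s same_x_same_g[OF _ tc, of s s'] by auto
    qed
    moreover have "x s tc \<le> x s' tc"
      using mono_onD[OF mono(2), of s s'] s s1(1) by simp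
    ultimately show "x s tc < x s' tc"
      by simp
  qed
  have "J s0 tc = J A tc"
    using J_mean_value[OF s0(1) monotone_on_subset[OF mono(1)]] s0(2) AB(2) by auto
  moreover have "J s1 tc = J B tc"
    using J_mean_value[OF s1(1) monotone_on_subset[OF mono(2)]] s1(2) AB(3) by auto
  ultimately have J01: "J s0 tc = J s1 tc"
    using AB(4) by simp
  have l0: "\<exists>l>0. (deriv (\<lambda>r. x r tc) \<longlongrightarrow> l) (at_left s0)"
    using deriv_x_left_pos[OF mono0 v] vg by blast
  have l1: "\<exists>l>0. (deriv (\<lambda>r. x r tc) \<longlongrightarrow> l) (at_right s1)"
    using deriv_x_right_pos[OF mono1 v] vg by blast
  have "equal_area_curve x g tc {(s0, s1)} (v(X := g s0))"
    by (rule one_shock_equal_area_curve[OF tc s01 s0(2) s1(2) J01 mono0 mono1 v vg l0 l1])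
  moreover have "propagates_at_RH_speed F x g tc s0 s1"
    using s0(2) s1(2) by (intro shock_propagates[OF tc s01 _ J01 l0 l1]) simp
  ultimately show ?thesis
    using s0(2) by blast
qed

end

theorem corollary1:
  fixes F g :: "real \<Rightarrow> real" and w :: "real \<Rightarrow> real \<Rightarrow> real"
    and t0 tc :: real and P Q :: "real \<Rightarrow> real"
  assumes "C2 F" and "uniformly_convex F"
    and "continuous_on UNIV g" and "piecewise_C1 g"
    and "entropy_weak_solution F g w"
    and "two_shocks_collide (characteristic_curve F g) g w t0 tc P Q"
    and "piecewise_smooth_except_shocks w t0 tc P Q"
  shows "\<exists>s0 s1. associated_equal_area_curve (characteristic_curve F g) g w tc {(s0, s1)} \<and>
           characteristic_curve F g s0 tc = P tc \<and>
           propagates_at_RH_speed F (characteristic_curve F g) g tc s0 s1"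
proof -
  have weak: "weak_solution F g w"
    using assms(5) unfolding entropy_weak_solution_def by blast
  then have w_meas: "\<And>t. t \<ge> 0 \<Longrightarrow> (\<lambda>X. w X t) \<in> borel_measurable lebesgue"
    and w_L1: "\<And>t R. t \<ge> 0 \<Longrightarrow> R > 0 \<Longrightarrow>
        ((\<lambda>r. LINT X:{- R..R}|lebesgue. \<bar>w X r - w X t\<bar>) \<longlongrightarrow> 0) (at t within {0..})"
    and w0: "AE X in lebesgue. w X 0 = g X"
    unfolding weak_solution_def by blast+
  obtain M where M: "\<And>t. t \<ge> 0 \<Longrightarrow> AE X in lebesgue. \<bar>w X t\<bar> \<le> M"
    using weak unfolding weak_solution_def by blast
  have "AE X in lebesgue. X \<in> UNIV \<longrightarrow> \<bar>g X - 0\<bar> \<le> M"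
    using w0 M[OF order_refl] by eventually_elim simp
  then have g_bound: "\<bar>g s\<bar> \<le> M" for s
    using AE_bound_imp_bound[OF open_UNIV assms(3)] by fastforce
  have "\<exists>G. \<forall>s. ((- \<infinity>::ereal) < ereal s \<longrightarrow> ereal s < \<infinity> \<longrightarrow> (G has_vector_derivative g s) (at s))"
    by (rule einterval_antiderivative) (use assms(3) in \<open>auto simp: continuous_on_eq_continuous_at\<close>)
  then obtain G where G: "\<And>s. (G has_real_derivative g s) (at s)"
    by (auto simp: has_real_derivative_iff_has_vector_derivative)
  obtain D where D: "\<And>a b. finite (D \<inter> {a..b})" "\<And>y. y \<notin> D \<Longrightarrow> g differentiable (at y)"
    "continuous_on (- D) (deriv g)"
    using assms(4) unfolding piecewise_C1_def by metis
  interpret characteristics F g G D M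
  proof
    show "(F has_real_derivative deriv F y) (at y)" "(deriv F has_real_derivative deriv (deriv F) y) (at y)" for y
      using assms(1) unfolding C2_def by (simp_all add: DERIV_deriv_iff_real_differentiable)
    show "continuous_on UNIV (deriv (deriv F))"
      using assms(1) unfolding C2_def by blast
    show "deriv (deriv F) y > 0" for y
      using assms(2) unfolding uniformly_convex_def by (metis order_less_le_trans)
    show "(g has_real_derivative deriv g s) (at s)" if "s \<notin> D" for s
      using D(2)[OF that] by (simp add: DERIV_deriv_iff_real_differentiable)
  qed (use assms(3,4) D g_bound G in auto)
  define X0 where "X0 = P tc"
  have t0: "0 \<le> t0" "t0 < tc" and P: "continuous_on {t0<..tc} P" and Q: "continuous_on {t0<..tc} Q"
    and PQ: "Q tc = X0"
    and before: "\<And>t. t \<in> {t0<..<tc} \<Longrightarrow> P t \<noteq> Q t \<and>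
        (\<exists>a0 a1 b0 b1. associated_equal_area_curve x g w t {(a0, a1), (b0, b1)} \<and> x a0 t = P t \<and> x b0 t = Q t)"
    using assms(6) unfolding two_shocks_collide_def X0_def by auto
  have tc: "tc > 0"
    using t0 by simp
  obtain v where v: "piecewise_C1 v" "continuous_on (- {X0}) v" "AE X in lebesgue. w X tc = v X"
  proof -
    have "tc \<in> {t0<..tc}"
      using t0 by simp
    from assms(7)[unfolded piecewise_smooth_except_shocks_def, rule_format, OF this] show thesis
      using that PQ by (auto simp: X0_def)
  qed
  define t where "t n = tc - (tc - t0) / (real n + 2)" for n
  have t_in: "t n \<in> {t0<..<tc}" for n
  proof -
    have "(tc - t0) / (real n + 2) < tc - t0"
      using t0 by (simp add: divide_less_eq)
    moreover have "(tc - t0) / (real n + 2) > 0"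
      using t0 by simp
    ultimately show ?thesis
      by (auto simp: t_def)
  qed
  have t_pos: "0 < t n" and t_less: "t n < tc" for n
    using t_in[of n] t0 by auto
  have "(\<lambda>n. (tc - t0) / (real n + 2)) \<longlonglongrightarrow> 0"
    using LIMSEQ_ignore_initial_segment[OF lim_const_over_n[of "tc - t0"], of 2] by (simp add: add.commute)
  then have "(\<lambda>n. tc - (tc - t0) / (real n + 2)) \<longlonglongrightarrow> tc - 0"
    by (intro tendsto_diff tendsto_const)
  then have t_lim: "t \<longlonglongrightarrow> tc"
    unfolding t_def by simp
  define Z where "Z n u a0 a1 b0 b1 \<longleftrightarrow> two_cuts (t n) u a0 a1 b0 b1 \<and> (AE X in lebesgue. w X (t n) = u X) \<and>
      \<bar>x a0 (t n) - X0\<bar> \<le> \<bar>P (t n) - X0\<bar> + \<bar>Q (t n) - X0\<bar> \<and>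
      \<bar>x b0 (t n) - X0\<bar> \<le> \<bar>P (t n) - X0\<bar> + \<bar>Q (t n) - X0\<bar>" for n u a0 a1 b0 b1
  have "\<exists>u a0 a1 b0 b1. Z n u a0 a1 b0 b1" for n
  proof -
    obtain a0 a1 b0 b1 u where "P (t n) \<noteq> Q (t n)" "equal_area_curve x g (t n) {(a0, a1), (b0, b1)} u"
      and u: "AE X in lebesgue. w X (t n) = u X" and ab: "x a0 (t n) = P (t n)" "x b0 (t n) = Q (t n)"
      using before[OF t_in[of n]] unfolding associated_equal_area_curve_def by blast
    then have "two_cuts (t n) u a0 a1 b0 b1 \<or> two_cuts (t n) u b0 b1 a0 a1"
      by (intro two_cuts_exist t_pos) simp_all
    moreover have "\<bar>x a0 (t n) - X0\<bar> \<le> \<bar>P (t n) - X0\<bar> + \<bar>Q (t n) - X0\<bar>"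
      "\<bar>x b0 (t n) - X0\<bar> \<le> \<bar>P (t n) - X0\<bar> + \<bar>Q (t n) - X0\<bar>"
      unfolding ab by simp_all
    ultimately show ?thesis
      using u unfolding Z_def by blast
  qed
  then obtain u a0 a1 b0 b1 where "\<And>n. Z n (u n) (a0 n) (a1 n) (b0 n) (b1 n)"
    by metis
  then have cuts: "\<And>n. two_cuts (t n) (u n) (a0 n) (a1 n) (b0 n) (b1 n)"
    and wu: "\<And>n. AE X in lebesgue. w X (t n) = u n X"
    and near: "\<And>n. \<bar>x (a0 n) (t n) - X0\<bar> \<le> \<bar>P (t n) - X0\<bar> + \<bar>Q (t n) - X0\<bar>"
      "\<And>n. \<bar>x (b0 n) (t n) - X0\<bar> \<le> \<bar>P (t n) - X0\<bar> + \<bar>Q (t n) - X0\<bar>"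
    unfolding Z_def by blast+
  have "(\<lambda>n. P (t n)) \<longlonglongrightarrow> X0" "(\<lambda>n. Q (t n)) \<longlonglongrightarrow> X0"
    using continuous_on_tendsto_compose[OF P t_lim] continuous_on_tendsto_compose[OF Q t_lim] t_in t0 PQ
    by (auto simp: X0_def less_imp_le)
  then have "(\<lambda>n. \<bar>P (t n) - X0\<bar> + \<bar>Q (t n) - X0\<bar>) \<longlonglongrightarrow> \<bar>X0 - X0\<bar> + \<bar>X0 - X0\<bar>"
    by (intro tendsto_intros)
  then have to0: "(\<lambda>n. \<bar>P (t n) - X0\<bar> + \<bar>Q (t n) - X0\<bar>) \<longlonglongrightarrow> 0"
    by simp
  have xa: "(\<lambda>n. x (a0 n) (t n)) \<longlonglongrightarrow> X0" and xb: "(\<lambda>n. x (b0 n) (t n)) \<longlonglongrightarrow> X0"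
    using Lim_null_comparison[OF always_eventually to0, of "\<lambda>n. x (a0 n) (t n) - X0"]
      Lim_null_comparison[OF always_eventually to0, of "\<lambda>n. x (b0 n) (t n) - X0"] near
    by (simp_all add: LIM_zero_cancel)
  obtain r A B where r: "strict_mono r" and AB: "(a0 \<circ> r) \<longlonglongrightarrow> A" "(b1 \<circ> r) \<longlonglongrightarrow> B" "A < B"
    "x A tc = X0" "x B tc = X0" "J A tc = J B tc"
    and mono: "mono_on {..A} (\<lambda>s. x s tc)" "mono_on {B..} (\<lambda>s. x s tc)"
    using two_cuts_limit[OF t_lim t_pos t_less cuts xa xb] by blast
  have tr_lim: "(t \<circ> r) \<longlonglongrightarrow> tc"
    using LIMSEQ_subseq_LIMSEQ[OF t_lim r] .
  then have "filterlim (t \<circ> r) (at tc within {0..}) sequentially"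
    unfolding filterlim_at using t_pos t_less by (auto intro!: always_eventually simp: less_imp_le less_imp_neq)
  then have L1: "(\<lambda>n. LINT X:{-R..R}|lebesgue. \<bar>w X ((t \<circ> r) n) - w X tc\<bar>) \<longlonglongrightarrow> 0" if "R > 0" for R
    using filterlim_compose[OF w_L1[OF less_imp_le[OF tc] that]] by blast
  have trace: "trace_on tc v S"
    if "S = {..<A} \<and> (\<forall>s\<in>S. x s tc \<le> X0) \<or> S = {B<..} \<and> (\<forall>s\<in>S. X0 \<le> x s tc)" for S
  proof (rule trace_on_limit[OF tr_lim _ AB(1,2) _ _ _ _ L1 _ v(3,2) that])
    show "(u \<circ> r) n (x s ((t \<circ> r) n)) = g s" if "s < (a0 \<circ> r) n \<or> (b1 \<circ> r) n < s" for n s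
      using cuts[of "r n"] that unfolding two_cuts_def by auto
    show "(\<lambda>X. w X ((t \<circ> r) n)) \<in> borel_measurable lebesgue" "AE X in lebesgue. \<bar>w X ((t \<circ> r) n)\<bar> \<le> M" for n
      using w_meas M t_pos[of "r n"] by (simp_all add: less_imp_le)
    show "(\<lambda>X. w X tc) \<in> borel_measurable lebesgue" "AE X in lebesgue. \<bar>w X tc\<bar> \<le> M"
      using w_meas M tc by (simp_all add: less_imp_le)
    show "AE X in lebesgue. w X ((t \<circ> r) n) = (u \<circ> r) n X" for n
      using wu[of "r n"] by simp
  qed
  have "x s tc \<le> X0" if "s \<in> {..<A}" for s
    using mono_onD[OF mono(1), of s A] that AB(4) by simp
  moreover have "X0 \<le> x s tc" if "s \<in> {B<..}" for s
    using mono_onD[OF mono(2), of B s] that AB(5) by simp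
  ultimately obtain s0 s1 where s: "equal_area_curve x g tc {(s0, s1)} (v(X0 := g s0))" "x s0 tc = X0"
    "propagates_at_RH_speed F x g tc s0 s1"
    using collision[OF tc AB(3-6) mono v(1,2) trace trace] by blast
  have "{X0} \<in> null_sets lebesgue"
    using negligible_iff_null_sets by blast
  then have "AE X in lebesgue. X \<notin> {X0}"
    by (rule AE_not_in)
  then have "AE X in lebesgue. w X tc = (v(X0 := g s0)) X"
    using v(3) by eventually_elim simp
  then show ?thesis
    using s unfolding associated_equal_area_curve_def X0_def by blast
qed

end
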